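(* Let $\beta>1$ be a simple Parry number with Rényi expansion of unity $d_\beta(1)=t_1t_2\cdots t_m$, $m\ge 2$, and let $u_\beta$ be the fixed point of the canonical substitution $\varphi$ associated with $\beta$. Then the factor complexity $\mathcal C$ of $u_\beta$ is an affine function (i.e. there are constants $a,b$ with $\mathcal C(n)=an+b$ for all $n\in\mathbb N$) if and only if both of the following hold: 1) $t_m=1$; 2) either $t_1\cdots t_{m-1}=w^k$ for some word $w$ and some integer $k\ge 2$, or no non-empty word is simultaneously a proper prefix and a proper suffix of the word $t_1t_2\cdots t_{m-1}$.
   Context: A simple Parry number is a real $\beta>1$ whose Rényi expansion of $1$ is finite: $d_\beta(1)=t_1\cdots t_m$ with nonnegative integer digits, $t_1=\lfloor\beta\rfloor\ge1$, $t_m\ge1$, $1=\sum_{i=1}^m t_i\beta^{-i}$. The digits satisfy the Parry condition: $t_it_{i+1}\cdots t_m0^\omega$ is lexicographically strictly smaller than $t_1\cdots t_m0^\omega$ for every $2\le i\le m$ (in particular $t_1\ge t_i$ for all $i$). The canonical substitution on the alphabet $\mathcal A=\{0,1,\dots,m-1\}$ is $\varphi(k)=0^{t_{k+1}}(k+1)$ for $0\le k\le m-2$ and $\varphi(m-1)=0^{t_m}$; it is primitive and $u_\beta=\lim_{n\to\infty}\varphi^n(0)$ is its unique fixed point. The factor complexity is $\mathcal C(n)=$ the number of distinct factors (finite contiguous subwords) of $u_\beta$ of length $n$. Words here are finite sequences of digits; $w^k$ denotes the concatenation of $k$ copies of $w$. *)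

theory Defs
  imports Complex_Main "HOL-Library.Sublist"
begin

(* Digits are given as a list t = [t_1, ..., t_m]; t_i = t ! (i-1). *)

definition pad_zero :: "nat list \<Rightarrow> nat \<Rightarrow> nat" where
  "pad_zero t j = (if j < length t then t ! j else 0)"

definition lex_less_seq :: "(nat \<Rightarrow> nat) \<Rightarrow> (nat \<Rightarrow> nat) \<Rightarrow> bool" where
  "lex_less_seq a b \<longleftrightarrow> (\<exists>k. (\<forall>j<k. a j = b j) \<and> a k < b k)"

definition simple_parry :: "real \<Rightarrow> nat list \<Rightarrow> bool" where
  "simple_parry \<beta> t \<longleftrightarrow>
     \<beta> > 1 \<and> length t \<ge> 1 \<and>
     int (t ! 0) = \<lfloor>\<beta>\<rfloor> \<and> t ! 0 \<ge> 1 \<and> last t \<ge> 1 \<and>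
     (\<Sum>i<length t. real (t ! i) / \<beta> ^ (i + 1)) = 1 \<and>
     (\<forall>i. 1 \<le> i \<and> i < length t \<longrightarrow>
        lex_less_seq (pad_zero (drop i t)) (pad_zero t))"

definition canon_subst :: "nat list \<Rightarrow> nat \<Rightarrow> nat list" where
  "canon_subst t k =
     (if k + 1 < length t then replicate (t ! k) 0 @ [k + 1]
      else replicate (t ! (length t - 1)) 0)"

definition subst_word :: "nat list \<Rightarrow> nat list \<Rightarrow> nat list" where
  "subst_word t w = concat (map (canon_subst t) w)"

(* u_beta = lim phi^n(0): the letter at position n is read off phi^(n+1)(0),
   which has length > n and is a prefix of all later iterates *)
definition u_beta :: "nat list \<Rightarrow> nat \<Rightarrow> nat" where
  "u_beta t n = ((subst_word t ^^ Suc n) [0]) ! n"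

definition factors :: "(nat \<Rightarrow> nat) \<Rightarrow> nat \<Rightarrow> nat list set" where
  "factors u n = {map u [i..<i + n] | i. True}"

definition complexity :: "(nat \<Rightarrow> nat) \<Rightarrow> nat \<Rightarrow> nat" where
  "complexity u n = card (factors u n)"

end

theory Submission
  imports Defs "HOL-Library.List_Lexorder"
begin

text \<open>
  The images of distinct letters end in distinct letters, so the substitution rotates left
  extensions and every prefix of the fixed point \<open>u\<close> is preceded by all \<open>m\<close> letters. Hence the
  complexity is affine iff no other factor is left special. Such a factor exists iff two
  occurrences of a branch, a prefix of \<open>u\<close> that is continued by a letter \<open>b\<close> instead of the expected
  letter \<open>c\<close>, are preceded by different letters. If \<open>t\<^sub>m \<ge> 2\<close>, the zeros of length \<open>t\<^sub>1 + 1\<close> form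
  such a branch.

  Let \<open>t\<^sub>m = 1\<close>. Under the substitution, \<open>b\<close> and \<open>c\<close> compete by the lengths of the zero runs they
  produce: the letter with the shorter run is increased by one, the other one becomes \<open>0\<close>, and both
  are increased if the runs agree. All branches arise in this way from those that start inside an
  image and are therefore preceded by \<open>0\<close>. So two branches with different left letters can merge
  only if two different letters \<open>b\<close> lose against the same \<open>c\<close> at the same position.

  Let \<open>w = t\<^sub>1\<dots>t\<^sub>m\<^sub>-\<^sub>1\<close>. By the Parry condition only the last letter, or a letter that descends from
  it, can lose; if every border of \<open>w\<close> is a period, as for a power, then as soon as a second letter
  becomes the last one, the first one never loses again. If \<open>w\<close> is bordered but not a power, let
  \<open>x\<close> be its shortest border and \<open>q\<close> maximal such that \<open>w = px\<^sup>q\<^sup>+\<^sup>1\<close>. Then the letters of index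
  \<open>|p|\<close> and \<open>|px|\<close> branch off at the same position with different left letters, and both of them
  finally lose against the same letter.
\<close>

section \<open>Borders and powers of words\<close>

lemma append_le_append_iff [simp]:
  fixes v w :: "'a::order list"
  shows "x @ v \<le> x @ w \<longleftrightarrow> v \<le> w"
  by (induction x) auto

lemma append_le_appendD:
  fixes v w :: "'a::order list"
  assumes "v @ x \<le> w @ y" "length v = length w"
  shows "v \<le> w"
  using assms(2,1) by (induction v w rule: list_induct2) auto

lemma prefix_imp_le:
  fixes v w :: "'a::order list"
  shows "prefix v w \<Longrightarrow> v \<le> w"
  using append_le_append_iff[of v "[]"] by (auto simp: prefix_def)

definition suffix_maximal :: "'a::order list \<Rightarrow> bool" where
  "suffix_maximal w \<longleftrightarrow> (\<forall>v. suffix v w \<longrightarrow> v \<le> w)"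

lemma suffix_maximalD: "suffix_maximal w \<Longrightarrow> w = x @ v \<Longrightarrow> v \<le> w"
  by (simp add: suffix_maximal_def suffix_def)

definition prefix_border :: "'a list \<Rightarrow> nat \<Rightarrow> nat \<Rightarrow> bool" where
  "prefix_border w c b \<longleftrightarrow> c < b \<and> b \<le> length w \<and> suffix (take c w) (take b w)"

lemma prefix_border_less: "prefix_border w c b \<Longrightarrow> c < b"
  and prefix_border_le_length: "prefix_border w c b \<Longrightarrow> b \<le> length w"
  by (simp_all add: prefix_border_def)

lemma prefix_border_asym: "prefix_border w b c \<Longrightarrow> \<not> prefix_border w c b"
  by (simp add: prefix_border_def)

lemma prefix_border_iff_nth:
  "prefix_border w c b \<longleftrightarrow> c < b \<and> b \<le> length w \<and> (\<forall>k<c. w ! (b - c + k) = w ! k)"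
proof -
  have "suffix (take c w) (take b w) \<longleftrightarrow> (\<forall>k<c. w ! (b - c + k) = w ! k)"
    if "c < b" "b \<le> length w"
  proof -
    have "suffix (take c w) (take b w) \<longleftrightarrow> drop (b - c) (take b w) = take c w"
      using that suffix_take[of "take c w" "take b w"] suffix_drop[of "b - c" "take b w"]
      by (metis append_eq_conv_conj diff_le_self length_take min.absorb2 order.trans less_imp_le)
    also have "\<dots> \<longleftrightarrow> (\<forall>k<c. w ! (b - c + k) = w ! k)"
      using that by (auto simp: list_eq_iff_nth_eq)
    finally show ?thesis .
  qed
  then show ?thesis by (auto simp: prefix_border_def)
qed

lemma prefix_border_0: "0 < b \<Longrightarrow> b \<le> length w \<Longrightarrow> prefix_border w 0 b"
  by (simp add: prefix_border_def)

lemma prefix_border_trans: "prefix_border w c b \<Longrightarrow> prefix_border w b a \<Longrightarrow> prefix_border w c a"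
  by (auto simp: prefix_border_def intro: suffix_order.trans)

lemma prefix_border_linear:
  "prefix_border w c a \<Longrightarrow> prefix_border w b a \<Longrightarrow> c < b \<Longrightarrow> prefix_border w c b"
  by (auto simp: prefix_border_def intro: suffix_length_suffix)

lemma prefix_border_Suc:
  "prefix_border w c b \<Longrightarrow> b < length w \<Longrightarrow> w ! b = w ! c \<Longrightarrow> prefix_border w (Suc c) (Suc b)"
  by (auto simp: prefix_border_iff_nth less_Suc_eq)

lemma suffix_maximal_nth_le:
  assumes "suffix_maximal w" "prefix_border w c b" "b < length w"
  shows "w ! b \<le> w ! c"
proof -
  have "c < length w" using assms prefix_border_less by fastforce
  obtain y where "take b w = y @ take c w"
    using assms(2) by (auto simp: prefix_border_def suffix_def)
  then have "w = y @ (take c w @ drop b w)" by (metis append_assoc append_take_drop_id)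
  then have "take c w @ drop b w \<le> take c w @ drop c w"
    using suffix_maximalD[OF assms(1)] by (metis append_take_drop_id)
  then have "drop b w \<le> drop c w" by (simp only: append_le_append_iff)
  then have "w ! b # drop (Suc b) w \<le> w ! c # drop (Suc c) w"
    using assms(3) \<open>c < length w\<close> by (simp add: Cons_nth_drop_Suc)
  then show ?thesis by auto
qed

lemma ex_proper_border_iff:
  "(\<exists>v. v \<noteq> [] \<and> strict_prefix v w \<and> strict_suffix v w) \<longleftrightarrow> (\<exists>s>0. prefix_border w s (length w))"
proof
  assume "\<exists>v. v \<noteq> [] \<and> strict_prefix v w \<and> strict_suffix v w"
  then obtain v where v_border: "v \<noteq> []" "strict_prefix v w" "strict_suffix v w" by blast
  then have "take (length v) w = v" by (auto simp: strict_prefix_def prefix_def)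
  moreover have "length v < length w" using v_border(2) by (rule prefix_length_less)
  ultimately have "prefix_border w (length v) (length w)"
    using v_border(3) by (simp add: prefix_border_def strict_suffix_def)
  then show "\<exists>s>0. prefix_border w s (length w)" using v_border(1) by blast
next
  assume "\<exists>s>0. prefix_border w s (length w)"
  then obtain s where s_border: "0 < s" "s < length w" "suffix (take s w) w"
    by (auto simp: prefix_border_def)
  then have "take s w \<noteq> w" "take s w \<noteq> []" by (auto dest: arg_cong[where f = length])
  then have "take s w \<noteq> [] \<and> strict_prefix (take s w) w \<and> strict_suffix (take s w) w"
    using s_border(3) by (simp add: strict_prefix_def strict_suffix_def take_is_prefix)
  then show "\<exists>v. v \<noteq> [] \<and> strict_prefix v w \<and> strict_suffix v w" by blast
qed

text \<open>\<open>prefix (drop s w) w\<close> says that \<open>s\<close> is a period of \<open>w\<close>.\<close>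

lemma nth_add_period:
  assumes "prefix (drop s w) w" "s + k < length w" shows "w ! (s + k) = w ! k"
proof -
  obtain y where "w = drop s w @ y" using assms(1) by (auto simp: prefix_def)
  then have "w ! k = (drop s w @ y) ! k" by simp
  moreover have "k < length (drop s w)" using assms(2) by simp
  ultimately show ?thesis by (simp add: nth_append)
qed

lemma prefix_border_add_period:
  assumes "prefix (drop s w) w" "0 < s" "s + c \<le> length w"
  shows "prefix_border w c (s + c)"
  using assms nth_add_period[OF assms(1)] by (simp add: prefix_border_iff_nth)

lemma suffix_maximal_mismatch:
  fixes w :: "'a::order list"
  assumes "suffix_maximal w" "0 < s" "\<not> prefix (drop s w) w"
  obtains e where "s + e < length w" "prefix_border w e (s + e)" "w ! (s + e) < w ! e"
proof -
  have "drop s w \<noteq> w" using assms(3) by auto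
  then have "drop s w < w"
    using assms(1) suffix_drop[of s w] by (simp add: suffix_maximal_def order_less_le)
  then obtain e where first_mismatch: "e < length (drop s w)"
    "take e (drop s w) = take e w" "drop s w ! e < w ! e"
    using assms(3) by (auto simp: list_less_def lexord_take_index_conv) (metis take_is_prefix)
  have "w ! (s + k) = w ! k" if "k < e" for k
    using arg_cong[OF first_mismatch(2), of "\<lambda>v. v ! k"] first_mismatch(1) that by simp
  then have "prefix_border w e (s + e)"
    using assms(2) first_mismatch(1) by (simp add: prefix_border_iff_nth)
  then show ?thesis using that[of e] first_mismatch(1,3) by simp
qed

abbreviation word_power :: "'a list \<Rightarrow> nat \<Rightarrow> 'a list" where
  "word_power z k \<equiv> concat (replicate k z)"

lemma length_word_power: "length (word_power z k) = k * length z"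
  by (induction k) auto

lemma word_power_commute: "x @ z = z @ x \<Longrightarrow> x @ word_power z k = word_power z k @ x"
  by (induction k) (simp_all, metis append_assoc)

lemma append_word_power: "x @ word_power x k @ v = word_power x k @ x @ v"
  using word_power_commute[of x x k] by (metis append_assoc)

definition proper_power :: "'a list \<Rightarrow> bool" where
  "proper_power w \<longleftrightarrow> (\<exists>z k. 2 \<le> k \<and> w = word_power z k)"

text \<open>
  If \<open>x\<close> is a prefix and a suffix of \<open>z = xy\<close>, comparing \<open>xyxy\<dots>\<close> with its suffixes \<open>xxy\<dots>\<close> and
  \<open>yxy\<dots>\<close> gives \<open>xy \<le> yx \<le> xy\<close>.
\<close>

lemma suffix_maximal_power_commute:
  fixes x y :: "'a::order list"
  assumes "suffix_maximal (word_power (x @ y) k)" "2 \<le> k" "suffix x (x @ y)"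
  shows "x @ y = y @ x"
proof (rule order_antisym)
  obtain v where x_suffix: "x @ y = v @ x" using assms(3) by (auto simp: suffix_def)
  obtain j where "k = Suc (Suc j)" using assms(2) by (metis add_2_eq_Suc le_Suc_ex)
  define r where "r = word_power (x @ y) j"
  have w_eq: "word_power (x @ y) k = x @ y @ x @ y @ r" by (simp add: \<open>k = Suc (Suc j)\<close> r_def)
  have "word_power (x @ y) k = (x @ y) @ (x @ y @ r)" by (simp add: w_eq)
  also have "\<dots> = v @ (x @ x @ y @ r)" by (simp add: x_suffix)
  finally have "word_power (x @ y) k = v @ (x @ x @ y @ r)" .
  from suffix_maximalD[OF assms(1) this] have "(x @ y) @ r \<le> (y @ x) @ y @ r" by (simp add: w_eq)
  then show "x @ y \<le> y @ x" by (rule append_le_appendD) simp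
  have "(y @ x) @ y @ r \<le> (x @ y) @ x @ y @ r"
    using suffix_maximalD[OF assms(1) w_eq] by (simp add: w_eq)
  then show "y @ x \<le> x @ y" by (rule append_le_appendD) simp
qed

lemma split_word_power:
  assumes "s < k * length z"
  obtains j x y i where "k = j + Suc i" "z = x @ y"
    "take s (word_power z k) = word_power z j @ x" "drop s (word_power z k) = y @ word_power z i"
proof -
  have "0 < length z" using assms by (cases z) auto
  define j x y where "j = s div length z" and "x = take (s mod length z) z"
    and "y = drop (s mod length z) z"
  have z_eq: "z = x @ y" by (simp add: x_def y_def)
  have "j < k" using assms by (simp add: j_def less_mult_imp_div_less)
  then obtain i where k_eq: "k = j + Suc i" by (metis less_imp_add_positive Suc_pred)
  have "word_power z k = word_power z j @ word_power z (Suc i)"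
    by (simp only: k_eq replicate_add concat_append)
  then have power_eq: "word_power z k = (word_power z j @ x) @ y @ word_power z i"
    by (simp add: z_eq)
  have "length x = s mod length z" using \<open>0 < length z\<close> by (simp add: x_def)
  then have "s = length (word_power z j @ x)" by (simp add: length_word_power j_def)
  then have "take s (word_power z k) = word_power z j @ x"
    "drop s (word_power z k) = y @ word_power z i"
    unfolding power_eq by simp_all
  then show ?thesis by (rule that[OF k_eq z_eq])
qed

lemma border_of_power_is_period:
  assumes "suffix_maximal w" "proper_power w" "prefix_border w s (length w)"
  shows "prefix (drop s w) w"
proof -
  obtain z k where exponent: "2 \<le> k" and w_eq: "w = word_power z k"
    using assms(2) by (auto simp: proper_power_def)
  have s_border: "s < k * length z" "suffix (take s w) w"
    using assms(3) by (simp_all add: prefix_border_def w_eq length_word_power)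
  obtain j x y i where split: "k = j + Suc i" "z = x @ y"
    "take s w = word_power z j @ x" "drop s w = y @ word_power z i"
    using split_word_power[OF s_border(1)] unfolding w_eq .
  have "suffix x w" using s_border(2) suffix_appendD unfolding split(3) by blast
  moreover have "suffix z w"
    using append_word_power[of z "j + i" "[]"] by (auto simp: w_eq split(1) suffix_def)
  ultimately have "suffix x (x @ y)" using suffix_length_suffix[of x w z] split(2) by simp
  then have xy: "x @ y = y @ x"
    using assms(1) exponent suffix_maximal_power_commute unfolding w_eq split(2) by blast
  then have commute: "x @ z = z @ x" by (simp add: split(2))
  have "w = x @ y @ word_power z i @ word_power z j"
    by (simp add: w_eq split(1,2) add.commute[of j] replicate_add)
  also have "\<dots> = (y @ word_power z i) @ x @ word_power z j"
    using xy word_power_commute[OF commute, of i] by (metis append_assoc)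
  finally show ?thesis unfolding split(4) by (metis prefixI)
qed

lemma prefix_power_if_suffix_power:
  assumes "suffix_maximal w" "prefix x w" "suffix (word_power x q) w"
  shows "prefix (word_power x q) w"
  using assms(3)
proof (induction q)
  case (Suc q)
  then have "suffix (word_power x q) w" by (auto dest: suffix_appendD)
  then obtain v where w_eq: "w = word_power x q @ v" using Suc.IH by (auto simp: prefix_def)
  have "word_power x (Suc q) = word_power x q @ x" using append_word_power[of x q "[]"] by simp
  moreover have "word_power x (Suc q) \<le> w"
    using assms(1) Suc.prems by (simp only: suffix_maximal_def)
  ultimately have "x \<le> v" by (simp add: w_eq)
  have "length (word_power x (Suc q)) \<le> length w" using Suc.prems by (rule suffix_length_le)
  then have "length x \<le> length v" by (simp add: w_eq)
  have "prefix x v"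
  proof (cases q)
    case 0
    then show ?thesis using assms(2) w_eq by simp
  next
    case (Suc j)
    have "w = x @ (word_power x j @ v)" by (simp add: w_eq Suc)
    then have "word_power x j @ v \<le> w" by (rule suffix_maximalD[OF assms(1)])
    also have "w = word_power x j @ x @ v" by (simp add: w_eq Suc append_word_power)
    finally have "take (length x) v @ drop (length x) v \<le> x @ v" by simp
    then have "take (length x) v \<le> x"
      by (rule append_le_appendD) (simp add: \<open>length x \<le> length v\<close>)
    moreover have "x @ [] \<le> take (length x) v @ drop (length x) v" using \<open>x \<le> v\<close> by simp
    then have "x \<le> take (length x) v"
      by (rule append_le_appendD) (simp add: \<open>length x \<le> length v\<close>)
    ultimately have "take (length x) v = x" by simp
    then show ?thesis by (metis take_is_prefix)
  qed
  then show ?case by (auto simp: w_eq prefix_def append_word_power)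
qed simp

lemma border_period_imp_proper_power:
  assumes "prefix_border w s (length w)" "0 < s" "prefix (drop s w) w"
  shows "proper_power w"
proof -
  define x y where "x = take s w" and "y = drop s w"
  have w_eq: "w = x @ y" by (simp add: x_def y_def)
  have "x \<noteq> []" "y \<noteq> []"
    using prefix_border_less[OF assms(1)] assms(2) by (auto simp: x_def y_def)
  obtain v where x_suffix: "w = v @ x"
    using assms(1) by (auto simp: prefix_border_def suffix_def x_def)
  obtain v' where "w = y @ v'" using assms(3) by (auto simp: prefix_def y_def)
  moreover have "length v = length y" using arg_cong[OF x_suffix, of length] by (simp add: w_eq)
  ultimately have "v = y" using x_suffix by auto
  then have "x @ y = y @ x" using x_suffix w_eq by simp
  then show ?thesis
    using comm_append_is_replicate[OF \<open>x \<noteq> []\<close> \<open>y \<noteq> []\<close>] unfolding w_eq proper_power_def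
    by (metis Suc_1 Suc_leI)
qed

lemma maximal_suffix_power:
  assumes "x \<noteq> []"
  obtains p q where "w = p @ word_power x q" "\<not> suffix x p"
proof -
  let ?R = "\<lambda>q. suffix (word_power x q) w"
  have "q \<le> length w" if "?R q" for q
  proof -
    have "q * 1 \<le> q * length x" using assms by (intro mult_le_mono2) (simp add: Suc_leI)
    also have "\<dots> \<le> length w" using suffix_length_le[OF that] by (simp add: length_word_power)
    finally show ?thesis by simp
  qed
  then have is_suffix: "?R (Greatest ?R)" and exponent_le: "\<And>q. ?R q \<Longrightarrow> q \<le> Greatest ?R"
    using GreatestI_nat[of ?R 0] Greatest_le_nat[of ?R] by auto
  then obtain p where w_eq: "w = p @ word_power x (Greatest ?R)" by (auto simp: suffix_def)
  have "\<not> suffix x p"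
  proof
    assume "suffix x p"
    then obtain v where "p = v @ x" by (auto simp: suffix_def)
    then have "?R (Suc (Greatest ?R))" using w_eq by (auto simp: suffix_def)
    then show False using exponent_le by fastforce
  qed
  then show ?thesis using that w_eq by blast
qed

lemma ex_shortest_border:
  assumes "0 < s" "prefix_border w s (length w)"
  obtains x where "x \<noteq> []" "prefix x w" "suffix x w" "length x < length w"
    "\<And>r. 0 < r \<Longrightarrow> r < length x \<Longrightarrow> \<not> prefix_border w r (length w)"
proof -
  let ?border = "\<lambda>s. 0 < s \<and> prefix_border w s (length w)"
  define l where "l = (LEAST s. ?border s)"
  have "?border l" using LeastI[of ?border] assms by (simp add: l_def)
  then have "0 < l" "l < length w" "suffix (take l w) w" by (simp_all add: prefix_border_def)
  moreover have "\<not> prefix_border w r (length w)" if "0 < r" "r < l" for r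
    using not_less_Least[of r ?border] that by (simp add: l_def)
  ultimately show ?thesis by (intro that[of "take l w"]) (auto simp: take_is_prefix)
qed

lemma bordered_nonpower_decomposition:
  assumes "suffix_maximal w" "0 < s" "prefix_border w s (length w)" "\<not> proper_power w"
  obtains p x q where "w = p @ x @ word_power x q" "prefix (x @ word_power x q) w"
    "\<And>r. 0 < r \<Longrightarrow> r < length x \<Longrightarrow> \<not> prefix_border w r (length w)"
    "p \<noteq> []" "x \<noteq> []" "\<not> suffix x p" "\<not> suffix p x"
proof -
  obtain x where x_border: "x \<noteq> []" "prefix x w" "suffix x w" "length x < length w"
    and shortest: "\<And>r. 0 < r \<Longrightarrow> r < length x \<Longrightarrow> \<not> prefix_border w r (length w)"
    by (rule ex_shortest_border[OF assms(2,3)]) blast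
  obtain p q where w_eq: "w = p @ word_power x q" and "\<not> suffix x p"
    using maximal_suffix_power[OF x_border(1)] .
  obtain j where q_eq: "q = Suc j" using w_eq x_border(3) \<open>\<not> suffix x p\<close> by (cases q) auto
  have "p \<noteq> []"
  proof
    assume "p = []"
    then have "j \<noteq> 0" using w_eq q_eq x_border(4) by (intro notI) simp
    then have "2 \<le> q" using q_eq by simp
    then show False using w_eq \<open>p = []\<close> assms(4) unfolding proper_power_def by auto
  qed
  have "\<not> suffix p x"
  proof
    assume "suffix p x"
    then have "suffix p w" using x_border(3) by (rule suffix_order.trans)
    have "length p \<le> length x" using \<open>suffix p x\<close> by (rule suffix_length_le)
    moreover have "length p \<noteq> length x"
      using \<open>suffix p x\<close> \<open>\<not> suffix x p\<close> by (auto simp: suffix_def)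
    ultimately have "length p < length x" by simp
    moreover have "prefix_border w (length p) (length w)"
      using \<open>suffix p w\<close> x_border(1) by (simp add: prefix_border_def w_eq q_eq)
    ultimately show False using shortest[of "length p"] \<open>p \<noteq> []\<close> by simp
  qed
  have "prefix (word_power x q) w"
    using assms(1) x_border(2) by (rule prefix_power_if_suffix_power) (simp add: w_eq suffix_def)
  then show ?thesis
    using that[of p x j] w_eq shortest x_border(1) \<open>p \<noteq> []\<close> \<open>\<not> suffix x p\<close> \<open>\<not> suffix p x\<close>
    unfolding q_eq by auto
qed

lemma suffix_incomparable_decomposition:
  assumes "\<not> suffix x p" "\<not> suffix p x"
  obtains x' h p' g z where "h \<noteq> g" "x = x' @ h # z" "p = p' @ g # z"
proof -
  have "rev x \<parallel> rev p" using assms by (simp add: parallel_def suffix_to_prefix)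
  then obtain z h x' g p' where "h \<noteq> g" "rev x = z @ h # x'" "rev p = z @ g # p'"
    using parallel_decomp by blast
  then have "x = rev x' @ h # rev z" "p = rev p' @ g # rev z"
    by (metis append.assoc append_Cons append_Nil rev.simps(2) rev_append rev_rev_ident)+
  then show ?thesis using that \<open>h \<noteq> g\<close> by blast
qed

section \<open>Complexity and left special factors\<close>

definition affine_seq :: "(nat \<Rightarrow> nat) \<Rightarrow> bool" where
  "affine_seq f \<longleftrightarrow> (\<exists>a b :: real. \<forall>n. real (f n) = a * real n + b)"

lemma affine_seq_iff: "affine_seq f \<longleftrightarrow> (\<forall>n. f (Suc n) + f 0 = f n + f 1)"
proof
  assume "affine_seq f"
  then obtain a b :: real where f_eq: "\<And>n. real (f n) = a * real n + b"
    by (auto simp: affine_seq_def)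
  have "real (f (Suc n) + f 0) = real (f n + f 1)" for n by (simp add: f_eq algebra_simps)
  then show "\<forall>n. f (Suc n) + f 0 = f n + f 1" unfolding of_nat_eq_iff by blast
next
  assume step: "\<forall>n. f (Suc n) + f 0 = f n + f 1"
  have "real (f n) = (real (f 1) - real (f 0)) * real n + real (f 0)" for n
  proof (induction n)
    case (Suc n)
    have "real (f (Suc n)) + real (f 0) = real (f n) + real (f 1)"
      using step by (simp only: of_nat_add[symmetric])
    then show ?case using Suc by (simp add: algebra_simps)
  qed simp
  then show "affine_seq f" unfolding affine_seq_def by blast
qed

abbreviation initial :: "(nat \<Rightarrow> nat) \<Rightarrow> nat \<Rightarrow> nat list" where
  "initial u L \<equiv> map u [0..<L]"

definition left_exts :: "(nat \<Rightarrow> nat) \<Rightarrow> nat list \<Rightarrow> nat set" where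
  "left_exts u v = {a. a # v \<in> factors u (Suc (length v))}"

definition left_special :: "(nat \<Rightarrow> nat) \<Rightarrow> nat list \<Rightarrow> bool" where
  "left_special u v \<longleftrightarrow> (\<exists>a\<in>left_exts u v. \<exists>b\<in>left_exts u v. a \<noteq> b)"

lemma factors_iff: "v \<in> factors u k \<longleftrightarrow> length v = k \<and> (\<exists>i. \<forall>j<k. u (i + j) = v ! j)"
proof -
  have "v = map u [i..<i + k] \<longleftrightarrow> length v = k \<and> (\<forall>j<k. u (i + j) = v ! j)" for i
    by (auto intro!: nth_equalityI)
  then show ?thesis by (simp add: factors_def)
qed

lemma factors_0: "factors u 0 = {[]}"
  by (simp add: factors_def)

lemma complexity_0: "complexity u 0 = 1"
  by (simp add: complexity_def factors_0)

lemma finite_factors: "finite (range u) \<Longrightarrow> finite (factors u k)"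
  by (rule finite_subset[OF _ finite_lists_length_eq[of "range u" k]]) (auto simp: factors_def)

lemma initial_in_factors: "initial u k \<in> factors u k"
  unfolding factors_iff by (auto intro!: exI[of _ 0])

lemma left_exts_iff:
  "a \<in> left_exts u v \<longleftrightarrow> (\<exists>i. u i = a \<and> (\<forall>k<length v. u (Suc i + k) = v ! k))"
  by (auto simp: left_exts_def factors_iff All_less_Suc2)

lemma in_factors_if_left_ext: "a \<in> left_exts u v \<Longrightarrow> v \<in> factors u (length v)"
  unfolding left_exts_iff factors_iff by blast

lemma left_exts_subset_range: "left_exts u v \<subseteq> range u"
  by (auto simp: left_exts_iff)

lemma complexity_Suc_eq_sum:
  assumes "finite (range u)"
  shows "complexity u (Suc k) = (\<Sum>v\<in>factors u k. card (left_exts u v))"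
proof -
  let ?pairs = "Sigma (factors u k) (left_exts u)"
  have "factors u (Suc k) = (\<lambda>(v, a). a # v) ` ?pairs"
  proof (intro equalityI subsetI)
    fix w assume w_factor: "w \<in> factors u (Suc k)"
    then obtain a v where w_eq: "w = a # v" "length v = k"
      by (auto simp: factors_iff length_Suc_conv)
    then have "a \<in> left_exts u v" using w_factor by (simp add: left_exts_def)
    then have "(v, a) \<in> ?pairs" using in_factors_if_left_ext w_eq(2) by blast
    then show "w \<in> (\<lambda>(v, a). a # v) ` ?pairs" using w_eq(1) by force
  qed (auto simp: left_exts_def factors_iff)
  moreover have "inj_on (\<lambda>(v, a). a # v) ?pairs" by (auto simp: inj_on_def)
  ultimately have "complexity u (Suc k) = card ?pairs" by (simp add: complexity_def card_image)
  also have "\<dots> = (\<Sum>v\<in>factors u k. card (left_exts u v))"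
    using assms finite_factors finite_subset[OF left_exts_subset_range] by simp
  finally show ?thesis .
qed

definition deviates :: "(nat \<Rightarrow> nat) \<Rightarrow> nat \<Rightarrow> nat \<Rightarrow> nat \<Rightarrow> bool" where
  "deviates u i L b \<longleftrightarrow> (\<forall>k<L. u (i + k) = u k) \<and> u (i + L) = b \<and> b \<noteq> u L"

definition branch :: "(nat \<Rightarrow> nat) \<Rightarrow> nat \<Rightarrow> nat \<Rightarrow> nat \<Rightarrow> bool" where
  "branch u a L b \<longleftrightarrow> (\<exists>i. u i = a \<and> deviates u (Suc i) L b)"

definition clash :: "(nat \<Rightarrow> nat) \<Rightarrow> nat \<Rightarrow> nat \<Rightarrow> nat \<Rightarrow> bool" where
  "clash u c b b' \<longleftrightarrow>
     (\<exists>L a a'. u L = c \<and> branch u a L b \<and> branch u a' L b' \<and> a \<noteq> a')"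

lemma deviates_unique: "deviates u i L b \<Longrightarrow> deviates u i L' b' \<Longrightarrow> L = L' \<and> b = b'"
  unfolding deviates_def by (metis linorder_neqE_nat)

lemma ex_deviates:
  assumes "u (i + l) \<noteq> u l" shows "\<exists>L b. deviates u i L b"
  using assms exists_least_iff[of "\<lambda>l. u (i + l) \<noteq> u l"] by (auto simp: deviates_def)

lemma branch_neq: "branch u a L b \<Longrightarrow> b \<noteq> u L"
  by (auto simp: branch_def deviates_def)

lemma branch_in_range: "branch u a L b \<Longrightarrow> a \<in> range u \<and> b \<in> range u"
  by (auto simp: branch_def deviates_def)

lemma clash_commute: "clash u c b b' \<Longrightarrow> clash u c b' b"
  unfolding clash_def by metis

lemma branch_iff_left_exts: "branch u a L b \<longleftrightarrow> b \<noteq> u L \<and> a \<in> left_exts u (initial u L @ [b])"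
proof -
  have "(\<forall>k<Suc L. u (Suc i + k) = (initial u L @ [b]) ! k) \<longleftrightarrow>
      (\<forall>k<L. u (Suc i + k) = u k) \<and> u (Suc i + L) = b" for i
    by (auto simp: less_Suc_eq nth_append)
  then show ?thesis by (auto simp: branch_def deviates_def left_exts_iff)
qed

lemma ex_left_special_iff_clash:
  "(\<exists>v. left_special u v \<and> v \<noteq> initial u (length v)) \<longleftrightarrow> (\<exists>c b. clash u c b b)"
proof
  assume "\<exists>v. left_special u v \<and> v \<noteq> initial u (length v)"
  then obtain v a a' where special: "a \<in> left_exts u v" "a' \<in> left_exts u v" "a \<noteq> a'"
    "v \<noteq> initial u (length v)" unfolding left_special_def by blast
  have "\<exists>L. L < length v \<and> v ! L \<noteq> u L"
    using special(4) nth_equalityI[of v "initial u (length v)"] by auto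
  then obtain L where mismatch: "L < length v" "v ! L \<noteq> u L"
    and least: "\<And>k. k < L \<Longrightarrow> \<not> (k < length v \<and> v ! k \<noteq> u k)"
    using exists_least_iff[of "\<lambda>L. L < length v \<and> v ! L \<noteq> u L"] by blast
  have "branch u c L (v ! L)" if c_ext: "c \<in> left_exts u v" for c
  proof -
    obtain i where occurrence: "u i = c" "\<forall>k<length v. u (Suc i + k) = v ! k"
      using c_ext unfolding left_exts_iff by blast
    have "u (Suc i + k) = u k" if "k < L" for k
      using occurrence(2) least[OF that] less_trans[OF that mismatch(1)] by simp
    then have "deviates u (Suc i) L (v ! L)"
      using occurrence(2) mismatch unfolding deviates_def by blast
    then show ?thesis using occurrence(1) by (auto simp: branch_def)
  qed
  then have "clash u (u L) (v ! L) (v ! L)" using special(1-3) unfolding clash_def by blast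
  then show "\<exists>c b. clash u c b b" by blast
next
  assume "\<exists>c b. clash u c b b"
  then obtain L a a' b where "a \<noteq> a'" "branch u a L b" "branch u a' L b"
    unfolding clash_def by blast
  then have "left_special u (initial u L @ [b])" and "b \<noteq> u L"
    unfolding branch_iff_left_exts left_special_def by blast+
  then show "\<exists>v. left_special u v \<and> v \<noteq> initial u (length v)"
    by (intro exI[of _ "initial u L @ [b]"]) simp
qed

locale left_universal_prefixes =
  fixes u :: "nat \<Rightarrow> nat"
  assumes finite_letters: "finite (range u)"
    and letter_before_prefix: "a \<in> range u \<Longrightarrow> \<exists>i. u i = a \<and> (\<forall>k<L. u (Suc i + k) = u k)"
begin

lemma left_exts_initial: "left_exts u (initial u k) = range u"
proof (rule equalityI[OF left_exts_subset_range subsetI])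
  fix a assume "a \<in> range u"
  then obtain i where "u i = a" "\<forall>j<k. u (Suc i + j) = u j" using letter_before_prefix by blast
  then show "a \<in> left_exts u (initial u k)" by (auto simp: left_exts_iff)
qed

lemma finite_left_exts: "finite (left_exts u v)"
  using finite_subset[OF left_exts_subset_range finite_letters] .

lemma left_exts_nonempty: "v \<in> factors u k \<Longrightarrow> left_exts u v \<noteq> {}"
proof -
  assume "v \<in> factors u k"
  then obtain i where occurrence: "length v = k" "\<forall>j<k. u (i + j) = v ! j"
    by (auto simp: factors_iff)
  show ?thesis
  proof (cases i)
    case 0
    then have "v = initial u k" using occurrence by (simp add: list_eq_iff_nth_eq)
    then show ?thesis by (simp add: left_exts_initial)
  next
    case (Suc j)
    then have "u j \<in> left_exts u v" using occurrence by (auto simp: left_exts_iff)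
    then show ?thesis by blast
  qed
qed

lemma left_special_iff_card: "left_special u v \<longleftrightarrow> 1 < card (left_exts u v)"
  using card_le_Suc0_iff_eq[OF finite_left_exts, of v] by (auto simp: left_special_def not_le)

lemma complexity_Suc:
  "complexity u (Suc k) + 1 = complexity u k + card (range u) +
     (\<Sum>v\<in>factors u k - {initial u k}. card (left_exts u v) - 1)"
proof -
  let ?F = "factors u k - {initial u k}"
  have finite_k: "finite (factors u k)" by (rule finite_factors[OF finite_letters])
  have "card (left_exts u v) = (card (left_exts u v) - 1) + 1" if "v \<in> ?F" for v
  proof -
    have "0 < card (left_exts u v)"
      using left_exts_nonempty finite_left_exts that by (auto simp: card_gt_0_iff)
    then show ?thesis by simp
  qed
  then have "(\<Sum>v\<in>?F. card (left_exts u v)) = (\<Sum>v\<in>?F. (card (left_exts u v) - 1) + 1)"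
    by (rule sum.cong[OF refl])
  also have "\<dots> = (\<Sum>v\<in>?F. card (left_exts u v) - 1) + card ?F"
    by (simp only: sum.distrib card_eq_sum)
  finally have "complexity u (Suc k) =
      card (range u) + (\<Sum>v\<in>?F. card (left_exts u v) - 1) + card ?F"
    using sum.remove[OF finite_k initial_in_factors, of "\<lambda>v. card (left_exts u v)"]
    by (simp add: complexity_Suc_eq_sum[OF finite_letters] left_exts_initial)
  moreover have "complexity u k = Suc (card ?F)"
    unfolding complexity_def by (rule card.remove[OF finite_k initial_in_factors])
  ultimately show ?thesis by simp
qed

theorem affine_complexity_iff_no_clash: "affine_seq (complexity u) \<longleftrightarrow> \<not> (\<exists>c b. clash u c b b)"
proof -
  have "complexity u 1 = card (range u)"
    using complexity_Suc[of 0] by (simp add: complexity_0 factors_0)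
  then have "affine_seq (complexity u) \<longleftrightarrow>
      (\<forall>k. (\<Sum>v\<in>factors u k - {initial u k}. card (left_exts u v) - 1) = 0)"
    using complexity_Suc by (simp add: affine_seq_iff complexity_0)
  also have "\<dots> \<longleftrightarrow> (\<forall>k. \<forall>v\<in>factors u k - {initial u k}. \<not> left_special u v)"
    using finite_factors[OF finite_letters] by (simp add: left_special_iff_card not_less)
  also have "\<dots> \<longleftrightarrow> \<not> (\<exists>v. left_special u v \<and> v \<noteq> initial u (length v))"
  proof -
    have "v \<in> factors u (length v)" if "left_special u v" for v
      using that in_factors_if_left_ext unfolding left_special_def by blast
    moreover have "length v = k" if "v \<in> factors u k" for v k
      using that by (simp add: factors_iff)
    ultimately show ?thesis by blast
  qed
  finally show ?thesis by (simp add: ex_left_special_iff_clash)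
qed

end

section \<open>Fixed points of substitutions\<close>

locale prolongable_substitution =
  fixes \<sigma> :: "'a \<Rightarrow> 'a list" and a :: 'a and v :: "'a list"
  assumes nonerasing: "\<sigma> x \<noteq> []"
    and prolongable: "\<sigma> a = a # v" "v \<noteq> []"
begin

definition image :: "'a list \<Rightarrow> 'a list" where "image w = concat (map \<sigma> w)"

definition iterate :: "nat \<Rightarrow> 'a list" where "iterate k = (image ^^ k) [a]"

definition u :: "nat \<Rightarrow> 'a" where "u i = iterate (Suc i) ! i"

definition pos :: "nat \<Rightarrow> nat" where "pos i = (\<Sum>j<i. length (\<sigma> (u j)))"

lemma image_append: "image (w @ w') = image w @ image w'"
  by (simp add: image_def)

lemma length_image: "length w \<le> length (image w)"
proof (induction w)
  case (Cons x w)
  then show ?case using nonerasing[of x] by (cases "\<sigma> x") (auto simp: image_def)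
qed (simp add: image_def)

lemma iterate_Suc: "iterate (Suc k) = image (iterate k)"
  by (simp add: iterate_def)

lemma prefix_iterate_Suc: "prefix (iterate k) (iterate (Suc k))"
proof (induction k)
  case 0
  show ?case by (simp add: iterate_def image_def prolongable)
next
  case (Suc k)
  then show ?case by (metis image_append iterate_Suc prefix_def)
qed

lemma prefix_iterate: "k \<le> l \<Longrightarrow> prefix (iterate k) (iterate l)"
  by (induction rule: dec_induct) (auto intro: prefix_order.trans prefix_iterate_Suc)

lemma length_iterate: "k < length (iterate k)"
proof (induction k)
  case 0
  show ?case by (simp add: iterate_def)
next
  case (Suc k)
  obtain w where w_eq: "iterate k = [a] @ w"
    using prefix_iterate[of 0 k] by (auto simp: iterate_def prefix_def)
  have "length (iterate (Suc k)) = length (\<sigma> a) + length (image w)"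
    unfolding iterate_Suc w_eq image_append by (simp add: image_def)
  then have "length (iterate k) < length (iterate (Suc k))"
    using length_image[of w] prolongable w_eq by (cases v) auto
  then show ?case using Suc by simp
qed

lemma u_eq_iterate_nth: "i < length (iterate k) \<Longrightarrow> u i = iterate k ! i"
proof -
  assume "i < length (iterate k)"
  moreover have "i < length (iterate (Suc i))" using length_iterate[of "Suc i"] by simp
  moreover have "prefix (iterate (Suc i)) (iterate k) \<or> prefix (iterate k) (iterate (Suc i))"
    using prefix_iterate nat_le_linear by blast
  ultimately show ?thesis by (auto simp: u_def prefix_def nth_append)
qed

lemma u_0: "u 0 = a"
  using u_eq_iterate_nth[of 0 0] by (simp add: iterate_def)

lemma pos_0: "pos 0 = 0" and pos_Suc: "pos (Suc i) = pos i + length (\<sigma> (u i))"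
  by (simp_all add: pos_def)

lemma u_pos: assumes "k < length (\<sigma> (u i))" shows "u (pos i + k) = \<sigma> (u i) ! k"
proof -
  have i_less: "i < length (iterate i)" by (rule length_iterate)
  define x y where "x = take i (iterate i)" and "y = drop (Suc i) (iterate i)"
  have "x = map u [0..<i]"
    using i_less by (intro nth_equalityI) (auto simp: x_def u_eq_iterate_nth[of _ i])
  then have "length (image x) = pos i"
    by (simp add: image_def length_concat pos_def comp_def sum_list_sum_nth atLeast0LessThan)
  have "iterate i = x @ u i # y"
    using i_less id_take_nth_drop[OF i_less] by (simp add: x_def y_def u_eq_iterate_nth)
  then have "iterate (Suc i) = image x @ \<sigma> (u i) @ image y"
    by (simp add: iterate_Suc image_def)
  then show ?thesis
    using assms \<open>length (image x) = pos i\<close>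
    by (subst u_eq_iterate_nth[of _ "Suc i"]) (auto simp: nth_append)
qed

lemma strict_mono_pos: "strict_mono pos"
  using nonerasing by (simp add: strict_mono_Suc_iff pos_Suc)

lemma less_pos: "0 < i \<Longrightarrow> i < pos i"
proof (induction i rule: nat_induct_non_zero)
  case 1
  show ?case using prolongable by (simp add: pos_def u_0)
next
  case (Suc i)
  then have "pos i < pos (Suc i)" by (simp add: strict_mono_less[OF strict_mono_pos])
  then show ?case using Suc by simp
qed

lemma le_pos: "i \<le> pos i"
  using less_pos[of i] by (cases i) auto

lemma image_containing:
  obtains i k where "p = pos i + k" "k < length (\<sigma> (u i))"
proof -
  have "\<exists>i k. p = pos i + k \<and> k < length (\<sigma> (u i))"
  proof (induction p)
    case 0
    have "0 = pos 0 + 0 \<and> 0 < length (\<sigma> (u 0))" using nonerasing by (simp add: pos_0)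
    then show ?case by blast
  next
    case (Suc p)
    then obtain i k where p_eq: "p = pos i + k" "k < length (\<sigma> (u i))" by blast
    show ?case
    proof (cases "Suc k < length (\<sigma> (u i))")
      case True
      then have "Suc p = pos i + Suc k \<and> Suc k < length (\<sigma> (u i))" using p_eq by simp
      then show ?thesis by blast
    next
      case False
      then have "Suc p = pos (Suc i) + 0 \<and> 0 < length (\<sigma> (u (Suc i)))"
        using p_eq nonerasing by (simp add: pos_Suc)
      then show ?thesis by blast
    qed
  qed
  then show ?thesis using that by blast
qed

lemma image_cases:
  obtains (start) i where "p = pos i"
  | (inside) i k where "p = pos i + k" "0 < k" "k < length (\<sigma> (u i))"
  by (metis image_containing add_0_right gr0I)

lemma ex_image_end: obtains p where "Suc p = pos (Suc i)"
  using less_pos[of "Suc i"] that by (cases "pos (Suc i)") auto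

lemma u_last_of_image: "Suc p = pos (Suc i) \<Longrightarrow> u p = last (\<sigma> (u i))"
proof -
  assume "Suc p = pos (Suc i)"
  then have "p = pos i + (length (\<sigma> (u i)) - 1)"
    using nonerasing[of "u i"] by (cases "\<sigma> (u i)") (auto simp: pos_Suc)
  then show ?thesis using u_pos[of _ i] nonerasing[of "u i"] by (simp add: last_conv_nth)
qed

lemma u_pos_hd: "u (pos i) = hd (\<sigma> (u i))"
  using u_pos[of 0 i] nonerasing[of "u i"] by (simp add: hd_conv_nth)

lemma u_in_image: obtains i where "u p \<in> set (\<sigma> (u i))"
  using image_containing[of p] u_pos nth_mem by metis

lemma successive_letters_induct:
  assumes inside: "\<And>x k. Suc k < length (\<sigma> x) \<Longrightarrow> R (\<sigma> x ! k) (\<sigma> x ! Suc k)"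
    and across: "\<And>x y. R x y \<Longrightarrow> R (last (\<sigma> x)) (hd (\<sigma> y))"
  shows "R (u p) (u (Suc p))"
proof (induction p rule: less_induct)
  case (less p)
  show ?case
  proof (cases "Suc p" rule: image_cases)
    case (start i)
    then obtain j where i_eq: "i = Suc j" by (cases i) (auto simp: pos_0)
    have "j < p" using less_pos[of i] start i_eq by simp
    then have "R (u j) (u i)" using less i_eq by simp
    then show ?thesis using across start i_eq u_last_of_image[of p j] u_pos_hd[of i] by simp
  next
    case (inside i k)
    then obtain l where "k = Suc l" by (cases k) auto
    then show ?thesis using inside assms(1)[of l "u i"] u_pos[of l i] u_pos[of k i] by simp
  qed
qed

lemma pos_add_agree:
  assumes "\<And>k. k < L \<Longrightarrow> u (i + k) = u k"
  shows "l \<le> L \<Longrightarrow> pos (i + l) = pos i + pos l"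
proof (induction l)
  case (Suc l)
  then show ?case using assms[of l] by (simp add: pos_Suc)
qed (simp add: pos_0)

lemma u_pos_agree:
  assumes "\<And>k. k < L \<Longrightarrow> u (i + k) = u k" "k < pos L"
  shows "u (pos i + k) = u k"
proof -
  obtain j l where k_eq: "k = pos j + l" "l < length (\<sigma> (u j))" by (rule image_containing)
  have "j < L" using k_eq assms(2) strict_mono_less[OF strict_mono_pos, of j L] by simp
  then have "u (i + j) = u j" "pos (i + j) = pos i + pos j"
    using assms(1) pos_add_agree[OF assms(1)] by auto
  then show ?thesis using u_pos[of l j] u_pos[of l "i + j"] k_eq by (simp add: add.assoc)
qed

end

section \<open>The canonical substitution\<close>

locale parry_substitution =
  fixes w :: "nat list" and d :: nat
  assumes nonempty: "w \<noteq> []"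
    and first_digit_pos: "0 < w ! 0"
    and last_digit_pos: "0 < d"
begin

abbreviation \<phi> :: "nat \<Rightarrow> nat list" where "\<phi> \<equiv> canon_subst (w @ [d])"

lemma subst_less: "x < length w \<Longrightarrow> \<phi> x = replicate (w ! x) 0 @ [Suc x]"
  by (simp add: canon_subst_def nth_append)

lemma subst_not_less: "\<not> x < length w \<Longrightarrow> \<phi> x = replicate d 0"
  by (simp add: canon_subst_def)

sublocale prolongable_substitution \<phi> 0 "replicate (w ! 0 - 1) 0 @ [1]"
proof
  show "\<phi> x \<noteq> []" for x using last_digit_pos by (auto simp: canon_subst_def)
  show "\<phi> 0 = 0 # replicate (w ! 0 - 1) 0 @ [1]"
    using nonempty first_digit_pos by (cases "w ! 0") (simp_all add: subst_less)
qed simp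

lemma u_beta_eq: "u_beta (w @ [d]) = u"
proof
  have "subst_word (w @ [d]) = image" by (simp add: subst_word_def image_def fun_eq_iff)
  then show "u_beta (w @ [d]) i = u i" for i by (simp add: u_beta_def u_def iterate_def)
qed

lemma u_le: "u i \<le> length w"
proof -
  obtain j where "u i \<in> set (\<phi> (u j))" by (rule u_in_image)
  then show ?thesis by (auto simp: canon_subst_def split: if_splits)
qed

lemma last_subst: "x \<le> length w \<Longrightarrow> last (\<phi> x) = Suc x mod Suc (length w)"
  using last_digit_pos by (cases "x < length w") (auto simp: subst_less subst_not_less)

lemma u_image_end: "Suc p = pos (Suc i) \<Longrightarrow> u p = Suc (u i) mod Suc (length w)"
  by (simp add: u_last_of_image last_subst u_le)

lemma u_Suc_zero_or_greater: "u (Suc i) = 0 \<or> u i < u (Suc i)"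
proof -
  let ?R = "\<lambda>x y. y \<le> length w \<and> (y = 0 \<or> x < y)"
  have "?R (u i) (u (Suc i))"
  proof (rule successive_letters_induct)
    show "?R (\<phi> x ! k) (\<phi> x ! Suc k)" if "Suc k < length (\<phi> x)" for x k
      using that by (cases "x < length w") (auto simp: subst_less subst_not_less nth_append)
    fix x y assume xy: "?R x y"
    show "?R (last (\<phi> x)) (hd (\<phi> y))"
    proof (cases "y < length w \<and> w ! y = 0")
      case True
      then have "y \<noteq> 0" using first_digit_pos by (intro notI) simp
      then show ?thesis using True xy by (simp add: subst_less)
    next
      case False
      then have "hd (\<phi> y) = 0"
        using last_digit_pos
        by (cases "y < length w") (auto simp: subst_less subst_not_less hd_append)
      then show ?thesis by simp
    qed
  qed
  then show ?thesis by blast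
qed

lemma u_after_last_letter: "u i = length w \<Longrightarrow> u (Suc i) = 0"
  using u_Suc_zero_or_greater[of i] u_le[of "Suc i"] by simp

text \<open>The image of the last letter is followed by the image of \<open>0\<close>, which extends its zeros.\<close>

definition zero_run :: "nat \<Rightarrow> nat" where
  "zero_run x = (if x < length w then w ! x else d + w ! 0)"

lemma u_zero_run: "k < zero_run (u i) \<Longrightarrow> u (pos i + k) = 0"
  and u_after_zero_run: "u (pos i + zero_run (u i)) = (if u i < length w then Suc (u i) else 1)"
proof -
  have run_less: "(\<forall>k<w ! u i. u (pos i + k) = 0) \<and> u (pos i + w ! u i) = Suc (u i)"
    if "u i < length w" for i
    using u_pos[of _ i] that by (auto simp: subst_less nth_append)
  have "(\<forall>k<zero_run (u i). u (pos i + k) = 0) \<and>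
    u (pos i + zero_run (u i)) = (if u i < length w then Suc (u i) else 1)"
  proof (cases "u i < length w")
    case True
    then show ?thesis using run_less[of i] by (simp add: zero_run_def)
  next
    case False
    then have "u (Suc i) = 0" using u_after_last_letter u_le[of i] by simp
    moreover have "pos (Suc i) = pos i + d" using False by (simp add: pos_Suc subst_not_less)
    ultimately have next_run: "\<forall>k<w ! 0. u (pos i + d + k) = 0" "u (pos i + d + w ! 0) = 1"
      using run_less[of "Suc i"] nonempty by auto
    have "u (pos i + k) = 0" if "k < d + w ! 0" for k
    proof (cases "k < d")
      case True
      then show ?thesis using u_pos[of k i] False by (simp add: subst_not_less)
    next
      case False
      then obtain l where "k = d + l" by (metis le_Suc_ex not_less)
      then show ?thesis using next_run that by (simp add: add.assoc)
    qed
    then show ?thesis using next_run False by (simp add: zero_run_def add.assoc)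
  qed
  then show "k < zero_run (u i) \<Longrightarrow> u (pos i + k) = 0"
    "u (pos i + zero_run (u i)) = (if u i < length w then Suc (u i) else 1)" by auto
qed

lemma zero_run_0: "zero_run 0 = w ! 0"
  using nonempty by (simp add: zero_run_def)

lemma u_first_zeros: "k < w ! 0 \<Longrightarrow> u k = 0"
  and u_after_first_zeros: "u (w ! 0) = 1"
  using u_zero_run[of k 0] u_after_zero_run[of 0] nonempty by (simp_all add: u_0 pos_0 zero_run_0)

lemma range_u: "range u = {..length w}"
proof
  show "{..length w} \<subseteq> range u"
  proof
    fix x assume "x \<in> {..length w}"
    then show "x \<in> range u"
    proof (induction x)
      case 0
      show ?case using u_0 by (metis rangeI)
    next
      case (Suc x)
      then obtain i where "u i = x" by auto
      then have "u (pos i + zero_run x) = Suc x" using u_after_zero_run[of i] Suc.prems by simp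
      then show ?case by (metis rangeI)
    qed
  qed
qed (use u_le in auto)

lemma ex_prefix_occurrence:
  "\<exists>i. u i = (length w + n) mod Suc (length w) \<and> (\<forall>k\<le>n. u (Suc i + k) = u k)"
proof (induction n)
  case 0
  have "length w \<in> range u" by (simp add: range_u)
  then obtain i where "u i = length w" by auto
  then show ?case using u_after_last_letter u_0 by auto
next
  case (Suc n)
  then obtain i where occurrence: "u i = (length w + n) mod Suc (length w)"
    "\<And>k. k < Suc n \<Longrightarrow> u (Suc i + k) = u k" by (auto simp: less_Suc_eq_le)
  obtain p where p_end: "Suc p = pos (Suc i)" by (rule ex_image_end)
  have "u p = (length w + Suc n) mod Suc (length w)"
    using u_image_end[OF p_end] occurrence(1) by (simp add: mod_Suc_eq)
  moreover have "u (Suc p + k) = u k" if "k \<le> Suc n" for k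
    unfolding p_end using that less_pos[of "Suc n"] by (intro u_pos_agree[OF occurrence(2)]) auto
  ultimately show ?case by blast
qed

sublocale left_universal_prefixes u
proof
  show "finite (range u)" by (simp add: range_u)
  fix a L assume "a \<in> range u"
  let ?n = "Suc a + Suc (length w) * L"
  have "(length w + ?n) mod Suc (length w) = (a + Suc (length w) * Suc L) mod Suc (length w)"
    by (simp add: algebra_simps)
  also have "\<dots> = a" using \<open>a \<in> range u\<close> by (simp only: mod_mult_self2) (simp add: range_u)
  finally obtain i where "u i = a" "\<forall>k\<le>?n. u (Suc i + k) = u k"
    using ex_prefix_occurrence[of ?n] by auto
  moreover have "k \<le> ?n" if "k < L" for k using that by simp
  ultimately show "\<exists>i. u i = a \<and> (\<forall>k<L. u (Suc i + k) = u k)" by blast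
qed

text \<open>
  The zeros at the image of the last letter contain two copies of \<open>0\<close> to the power \<open>t\<^sub>1 + 1\<close>, the
  first one preceded by a nonzero letter and the second one by \<open>0\<close>.
\<close>

lemma clash_if_last_digit_ge_2:
  assumes "2 \<le> d" shows "clash u 1 0 0"
proof -
  have "length w \<in> range u" by (simp add: range_u)
  then obtain i where last_letter: "u (Suc i) = length w"
    using u_0 nonempty by (metis imageE length_0_conv not0_implies_Suc)
  then have "u i \<noteq> length w" using u_after_last_letter[of i] nonempty by auto
  obtain p where p_end: "Suc p = pos (Suc i)" by (rule ex_image_end)
  have "u p \<noteq> 0" using u_image_end[OF p_end] \<open>u i \<noteq> length w\<close> u_le[of i] by simp
  have zeros: "u (Suc p + k) = 0" if "k < d + w ! 0" for k
    using u_zero_run[of k "Suc i"] that by (simp add: p_end last_letter zero_run_def)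
  have "deviates u (Suc p) (w ! 0) 0" "deviates u (Suc (Suc p)) (w ! 0) 0"
    using zeros zeros[of "Suc _"] assms u_first_zeros u_after_first_zeros
    by (auto simp: deviates_def)
  then have "branch u (u p) (w ! 0) 0" "branch u (u (Suc p)) (w ! 0) 0" by (auto simp: branch_def)
  moreover have "u (Suc p) = 0" using zeros[of 0] assms by simp
  ultimately show ?thesis
    using \<open>u p \<noteq> 0\<close> u_after_first_zeros unfolding clash_def by metis
qed

end

section \<open>The evolution of branches\<close>

locale unit_parry_substitution = parry_substitution +
  assumes maximal: "suffix_maximal w"
    and last_digit: "d = 1"
begin

abbreviation border_of :: "nat \<Rightarrow> nat \<Rightarrow> bool"  (infix \<open>\<sqsubset>\<close> 50) where
  "c \<sqsubset> b \<equiv> prefix_border w c b"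

lemma digit_le: "c \<sqsubset> b \<Longrightarrow> b < length w \<Longrightarrow> w ! b \<le> w ! c"
  using suffix_maximal_nth_le[OF maximal] .

lemma digit_le_first: "x < length w \<Longrightarrow> w ! x \<le> w ! 0"
  using digit_le[of 0 x] prefix_border_0[of x w] by (cases "x = 0") auto

lemma zero_run_less: "x < length w \<Longrightarrow> zero_run x = w ! x"
  by (simp add: zero_run_def)

lemma zero_run_less_last: "x < length w \<Longrightarrow> zero_run x < zero_run (length w)"
  using digit_le_first[of x] last_digit_pos by (simp add: zero_run_def)

lemma less_length_if_zero_run_le:
  assumes "zero_run b \<le> zero_run c" "b \<noteq> c" "b \<le> length w" "c \<le> length w"
  shows "b < length w"
  using assms zero_run_less_last[of c] by (cases "b = length w") auto

text \<open>
  If \<open>b\<close> appears where the beginning of \<open>u\<close> has \<open>c\<close>, then the images of \<open>b\<close> and \<open>c\<close> first differ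
  after \<open>min (zero_run b) (zero_run c)\<close> zeros, with \<open>derived b c\<close> against \<open>derived c b\<close>.
\<close>

definition derived :: "nat \<Rightarrow> nat \<Rightarrow> nat" where
  "derived b c = (if zero_run b \<le> zero_run c then Suc b else 0)"

definition derived_length :: "nat \<Rightarrow> nat \<Rightarrow> nat" where
  "derived_length L b = pos L + min (zero_run b) (zero_run (u L))"

lemma derived_neq: "b \<noteq> c \<Longrightarrow> derived b c \<noteq> derived c b"
  by (auto simp: derived_def)

lemma u_after_common_zeros:
  assumes "u i \<noteq> c" "c \<le> length w"
  shows "u (pos i + min (zero_run (u i)) (zero_run c)) = derived (u i) c"
proof (cases "zero_run (u i) \<le> zero_run c")
  case True
  then show ?thesis
    using u_after_zero_run[of i] less_length_if_zero_run_le[of "u i" c] assms u_le[of i]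
    by (simp add: derived_def)
next
  case False
  then show ?thesis using u_zero_run[of "zero_run c" i] by (simp add: derived_def)
qed

lemma u_derived_length:
  "b \<noteq> u L \<Longrightarrow> b \<le> length w \<Longrightarrow> u (derived_length L b) = derived (u L) b"
  using u_after_common_zeros[of L b] by (simp add: derived_length_def min.commute)

lemma deviates_image:
  assumes "deviates u i L b"
  shows "deviates u (pos i) (derived_length L b) (derived b (u L))"
proof -
  have agree: "\<And>k. k < L \<Longrightarrow> u (i + k) = u k" and differ: "u (i + L) = b" "b \<noteq> u L"
    using assms by (auto simp: deviates_def)
  have "pos (i + L) = pos i + pos L" using pos_add_agree[OF agree] by simp
  then have at_L: "u (pos i + (pos L + k)) = u (pos (i + L) + k)" for k by (simp add: add.assoc)
  have "u (pos i + k) = u k" if "k < derived_length L b" for k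
  proof (cases "k < pos L")
    case True
    then show ?thesis using u_pos_agree[OF agree] by blast
  next
    case False
    then obtain l where k_eq: "k = pos L + l" by (metis le_Suc_ex not_less)
    then have "l < zero_run b" "l < zero_run (u L)" using that by (auto simp: derived_length_def)
    then show ?thesis
      using u_zero_run[of l "i + L"] u_zero_run[of l L] at_L[of l] differ k_eq by simp
  qed
  moreover have "u (pos i + derived_length L b) = derived b (u L)"
    using u_after_common_zeros[of "i + L" "u L"] differ u_le at_L by (simp add: derived_length_def)
  moreover have "derived b (u L) \<noteq> u (derived_length L b)"
    using u_derived_length[of b L] derived_neq differ u_le by metis
  ultimately show ?thesis by (simp add: deviates_def)
qed

lemma deviates_image_converse:
  assumes "deviates u (pos i) L b"
  obtains L' b' where "deviates u i L' b'" "L = derived_length L' b'" "b = derived b' (u L')"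
proof -
  have "\<exists>l. u (i + l) \<noteq> u l"
  proof (rule ccontr)
    assume "\<not> ?thesis"
    then have "u (pos i + L) = u L"
      using le_pos[of "Suc L"] by (intro u_pos_agree[of "Suc L"]) auto
    then show False using assms by (auto simp: deviates_def)
  qed
  then obtain L' b' where "deviates u i L' b'" using ex_deviates by blast
  then show ?thesis using that deviates_unique[OF assms] deviates_image by blast
qed

lemma deviates_inside_image:
  assumes "u i < length w" "j < w ! u i"
  shows "deviates u (pos i + (w ! u i - j)) j (Suc (u i))"
proof -
  have "j < w ! 0" using digit_le_first assms by (meson less_le_trans)
  then have "u (pos i + (w ! u i - j) + k) = u k" if "k < j" for k
    using u_zero_run[of "w ! u i - j + k" i] u_first_zeros[of k] assms that
    by (simp add: zero_run_less add.assoc)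
  moreover have "u (pos i + (w ! u i - j) + j) = Suc (u i)"
    using u_after_zero_run[of i] assms by (simp add: zero_run_less add.assoc)
  ultimately show ?thesis using u_first_zeros[OF \<open>j < w ! 0\<close>] by (simp add: deviates_def)
qed

lemma branch_le: "branch u a L b \<Longrightarrow> a \<le> length w \<and> b \<le> length w"
  using branch_in_range[of u a L b] by (auto simp: range_u)

lemma branch_root:
  assumes "x < length w" "j < w ! x" shows "branch u 0 j (Suc x)"
proof -
  obtain i where i_letter: "u i = x"
    using assms(1) range_u by (metis atMost_iff imageE less_imp_le)
  obtain k where k_eq: "w ! x - j = Suc k" using assms(2) by (metis Suc_diff_Suc)
  have "u (pos i + k) = 0"
    using u_zero_run[of k i] assms i_letter k_eq by (simp add: zero_run_less)
  moreover have "deviates u (Suc (pos i + k)) j (Suc x)"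
    using deviates_inside_image[of i j] assms i_letter k_eq by simp
  ultimately show ?thesis by (auto simp: branch_def)
qed

lemma branch_derived:
  assumes "branch u a L b"
  shows "branch u (Suc a mod Suc (length w)) (derived_length L b) (derived b (u L))"
proof -
  obtain i where position: "u i = a" "deviates u (Suc i) L b"
    using assms by (auto simp: branch_def)
  obtain p where p_end: "Suc p = pos (Suc i)" by (rule ex_image_end)
  show ?thesis
    using u_image_end[OF p_end] deviates_image[OF position(2)] position(1)
    unfolding branch_def p_end[symmetric] by blast
qed

lemma branch_induct [consumes 1, case_names root derived]:
  assumes "branch u a L b"
    and root: "\<And>x j. x < length w \<Longrightarrow> j < w ! x \<Longrightarrow> Q 0 j (Suc x)"
    and derived: "\<And>a L b. branch u a L b \<Longrightarrow> Q a L b \<Longrightarrow>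
      Q (Suc a mod Suc (length w)) (derived_length L b) (derived b (u L))"
  shows "Q a L b"
proof -
  have "deviates u (Suc p) L b \<Longrightarrow> Q (u p) L b" for p L b
  proof (induction p arbitrary: L b rule: less_induct)
    case (less p)
    show ?case
    proof (cases "Suc p" rule: image_cases)
      case (start i)
      then obtain j where i_eq: "i = Suc j" by (cases i) (auto simp: pos_0)
      obtain L' b' where deviation: "deviates u (Suc j) L' b'"
        "L = derived_length L' b'" "b = derived b' (u L')"
        using deviates_image_converse less.prems start i_eq by metis
      moreover have "j < p" using less_pos[of i] start i_eq by simp
      ultimately have "Q (u j) L' b'" using less.IH by blast
      moreover have "branch u (u j) L' b'" using deviation(1) by (auto simp: branch_def)
      ultimately show ?thesis using derived deviation u_image_end[of p j] start i_eq by simp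
    next
      case (inside i k)
      have "length (\<phi> (u i)) = 1" if "\<not> u i < length w"
        using subst_not_less[OF that] last_digit by (simp only: length_replicate)
      then have letter_less: "u i < length w" using inside by linarith
      then have k_le: "k \<le> w ! u i" using inside by (simp add: subst_less)
      then have "deviates u (Suc p) (w ! u i - k) (Suc (u i))"
        using deviates_inside_image[OF letter_less, of "w ! u i - k"] inside by simp
      then have "L = w ! u i - k" "b = Suc (u i)" using deviates_unique less.prems by blast+
      moreover obtain l where "k = Suc l" using inside by (cases k) auto
      moreover have "u p = 0"
        using u_zero_run[of l i] inside letter_less k_le \<open>k = Suc l\<close> by (simp add: zero_run_less)
      ultimately show ?thesis using root[OF letter_less, of L] k_le by simp
    qed
  qed
  then show ?thesis using assms(1) by (auto simp: branch_def)
qed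

lemma branch_cases [consumes 1, case_names root derived]:
  assumes "branch u a L b"
  obtains x where "x < length w" "a = 0" "L < w ! x" "b = Suc x"
  | a' L' b' where "branch u a' L' b'" "a = Suc a' mod Suc (length w)"
    "L = derived_length L' b'" "b = derived b' (u L')"
  using assms
proof (induction rule: branch_induct)
  case (root x j)
  then show ?case by blast
next
  case (derived a L b)
  then show ?case by blast
qed

lemma derived_comparable:
  assumes "c \<sqsubset> b"
  shows "derived c b \<sqsubset> derived b c \<or> derived b c \<sqsubset> derived c b"
proof (cases "b < length w")
  case True
  then have zero_runs: "zero_run b = w ! b" "zero_run c = w ! c"
    using prefix_border_less[OF assms] by (simp_all add: zero_run_less)
  show ?thesis
  proof (cases "w ! b = w ! c")
    case True
    then show ?thesis
      using prefix_border_Suc[OF assms \<open>b < length w\<close>] zero_runs by (simp add: derived_def)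
  next
    case False
    then have "w ! b < w ! c" using digit_le[OF assms] True by simp
    then show ?thesis using zero_runs True by (simp add: derived_def prefix_border_0)
  qed
next
  case False
  then have "b = length w" "c < length w"
    using assms prefix_border_less prefix_border_le_length by fastforce+
  then show ?thesis using zero_run_less_last[of c] by (simp add: derived_def prefix_border_0)
qed

lemma branch_comparable: "branch u a L b \<Longrightarrow> b \<sqsubset> u L \<or> u L \<sqsubset> b"
proof (induction rule: branch_induct)
  case (root x j)
  then have "u j = 0" using u_first_zeros digit_le_first less_le_trans by blast
  then show ?case using root by (simp add: prefix_border_0)
next
  case (derived a L b)
  then have "u (derived_length L b) = derived (u L) b"
    using u_derived_length branch_neq branch_le by blast
  then show ?case using derived.IH derived_comparable by auto
qed

section \<open>No clash if every border is a period\<close>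

lemma branch_predecessor:
  assumes "branch u a L b" "u L = Suc c"
  obtains a' L' b' where "branch u a' L' b'" "u L' = c" "L' < L" "L = pos L' + zero_run c"
    "zero_run c \<le> zero_run b'" "b = derived b' c"
  using assms(1)
proof (cases rule: branch_cases)
  case (root x)
  then have "u L = 0" using u_first_zeros digit_le_first less_le_trans by blast
  then show ?thesis using assms(2) by simp
next
  case (derived a' L' b')
  then have "derived (u L') b' = Suc c"
    using u_derived_length[of b' L'] branch_neq branch_le assms(2) by metis
  then have letters: "u L' = c" "zero_run c \<le> zero_run b'"
    by (auto simp: derived_def split: if_splits)
  then have L_eq: "L = pos L' + zero_run c" using derived(3) by (simp add: derived_length_def)
  have "L' < L"
  proof (cases "L' = 0")
    case True
    then show ?thesis using L_eq letters(1) u_0 first_digit_pos by (simp add: pos_0 zero_run_0)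
  qed (use L_eq less_pos[of L'] in simp)
  then show ?thesis using that derived letters L_eq by blast
qed

text \<open>
  If \<open>c\<close> derives \<open>c + 1\<close>, only a trailing letter can derive \<open>0\<close>, or more generally some
  \<open>b \<sqsubset> c + 1\<close>, against it.
\<close>

definition trailing :: "nat \<Rightarrow> nat \<Rightarrow> bool" where
  "trailing b c \<longleftrightarrow> b \<sqsubset> c \<or> b = length w \<and> c \<sqsubset> length w"

lemma branch_trailing:
  assumes "branch u a L b" "zero_run (u L) \<le> zero_run b" "derived b (u L) \<sqsubset> Suc (u L)"
  shows "trailing b (u L)"
proof (rule ccontr)
  assume "\<not> trailing b (u L)"
  then have behind: "u L \<sqsubset> b" "b \<noteq> length w"
    using branch_comparable[OF assms(1)] by (auto simp: trailing_def)
  then have b_less: "b < length w" using branch_le[OF assms(1)] by simp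
  have "w ! b = w ! u L"
    using digit_le[OF behind(1) b_less] assms(2) b_less prefix_border_less[OF behind(1)]
    by (simp add: zero_run_less)
  then have "derived b (u L) = Suc b" "Suc (u L) \<sqsubset> Suc b"
    using prefix_border_Suc[OF behind(1) b_less] b_less prefix_border_less[OF behind(1)]
    by (auto simp: derived_def zero_run_less)
  then show False using assms(3) prefix_border_asym[of w "Suc b" "Suc (u L)"] by simp
qed

context
  assumes border_is_period: "\<And>s. 0 < s \<Longrightarrow> s \<sqsubset> length w \<Longrightarrow> prefix (drop s w) w"
begin

definition lagging :: "nat \<Rightarrow> nat \<Rightarrow> bool" where
  "lagging b c \<longleftrightarrow> b \<sqsubset> c \<and> (\<exists>s>0. s \<sqsubset> length w \<and> s \<le> c \<and> c \<le> b + s)"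

lemma lagging_if_suffix: "b \<sqsubset> c \<Longrightarrow> c \<sqsubset> length w \<Longrightarrow> lagging b c"
  using prefix_border_less[of w b c] unfolding lagging_def by (intro conjI exI[of _ c]) auto

lemma lagging_same_digit:
  assumes "lagging b c" "c < length w"
  shows "w ! b = w ! c"
proof (rule order_antisym)
  obtain s where s_border: "0 < s" "s \<sqsubset> length w" "s \<le> c" "c \<le> b + s" and "b \<sqsubset> c"
    using assms(1) by (auto simp: lagging_def)
  define r where "r = c - s"
  have c_eq: "c = s + r" using s_border(3) by (simp add: r_def)
  have period: "prefix (drop s w) w" using border_is_period s_border by blast
  have "r \<sqsubset> c" using prefix_border_add_period[OF period] s_border(1) assms(2) by (simp add: c_eq)
  have "w ! b \<le> w ! r"
  proof (cases "r = b")
    case False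
    then have "r < b" using s_border(4) c_eq by simp
    then have "r \<sqsubset> b" using prefix_border_linear \<open>r \<sqsubset> c\<close> \<open>b \<sqsubset> c\<close> by blast
    moreover have "b < length w" using prefix_border_less[OF \<open>b \<sqsubset> c\<close>] assms(2) by simp
    ultimately show ?thesis by (rule digit_le)
  qed simp
  then show "w ! b \<le> w ! c" using nth_add_period[OF period] assms(2) by (simp add: c_eq)
  show "w ! c \<le> w ! b" using digit_le[OF \<open>b \<sqsubset> c\<close> assms(2)] .
qed

lemma lagging_same_zero_run: "lagging b c \<Longrightarrow> c < length w \<Longrightarrow> zero_run b = zero_run c"
  using lagging_same_digit[of b c] prefix_border_less[of w b c]
  by (simp add: lagging_def zero_run_less)

lemma lagging_derived:
  assumes "lagging b c" "c < length w" shows "lagging (derived b c) (Suc c)"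
proof -
  have "derived b c = Suc b" using lagging_same_zero_run[OF assms] by (simp add: derived_def)
  moreover have "Suc b \<sqsubset> Suc c"
    using prefix_border_Suc[of w b c] lagging_same_digit[OF assms] assms by (simp add: lagging_def)
  ultimately show ?thesis using assms(1) by (auto simp: lagging_def intro: le_SucI)
qed

lemma trailing_pair_lagging:
  "branch u a L b \<Longrightarrow> branch u a' L b' \<Longrightarrow> b \<noteq> b' \<Longrightarrow>
    trailing b (u L) \<Longrightarrow> trailing b' (u L) \<Longrightarrow> lagging b (u L) \<or> lagging b' (u L)"
proof (induction L arbitrary: a b a' b' rule: less_induct)
  case (less L)
  show ?case
  proof (cases "b \<sqsubset> u L \<and> b' \<sqsubset> u L")
    case False
    then show ?thesis using less.prems lagging_if_suffix by (auto simp: trailing_def)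
  next
    case True
    then have "u L \<noteq> 0" using prefix_border_less[of w b "u L"] by auto
    then obtain c where c_eq: "u L = Suc c" using not0_implies_Suc by blast
    obtain a1 L1 b1 where pred: "branch u a1 L1 b1" "u L1 = c" "L1 < L"
      "L = pos L1 + zero_run c" "zero_run c \<le> zero_run b1" "b = derived b1 c"
      using branch_predecessor[OF less.prems(1) c_eq] .
    obtain a2 L2 b2 where pred': "branch u a2 L2 b2" "u L2 = c" "L2 < L"
      "L = pos L2 + zero_run c" "zero_run c \<le> zero_run b2" "b' = derived b2 c"
      using branch_predecessor[OF less.prems(2) c_eq] .
    have "L2 = L1" using pred(4) pred'(4) strict_mono_eq[OF strict_mono_pos] by simp
    moreover have "trailing b1 c" "trailing b2 c"
      using branch_trailing[OF pred(1)] branch_trailing[OF pred'(1)] pred pred' True c_eq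
      by simp_all
    ultimately have "lagging b1 c \<or> lagging b2 c"
      using less.IH[OF pred(3,1), of a2 b2] pred pred' less.prems(3) by auto
    moreover have "c < length w" using u_le[of L] c_eq by simp
    ultimately show ?thesis using lagging_derived pred(6) pred'(6) c_eq by auto
  qed
qed

lemma losing_letter_unique:
  assumes "branch u a L b" "branch u a' L b'"
    and "zero_run (u L) < zero_run b" "zero_run (u L) < zero_run b'"
  shows "b = b'"
proof (rule ccontr)
  assume "b \<noteq> b'"
  have c_less: "u L < length w"
    using less_length_if_zero_run_le[of "u L" b] assms(1,3) branch_neq branch_le u_le by fastforce
  have "trailing x (u L)" if "branch u y L x" "zero_run (u L) < zero_run x" for x y
    using branch_trailing[OF that(1)] that(2) c_less by (simp add: derived_def prefix_border_0)
  then have "lagging b (u L) \<or> lagging b' (u L)"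
    using trailing_pair_lagging[OF assms(1,2) \<open>b \<noteq> b'\<close>] assms by blast
  then show False using lagging_same_zero_run c_less assms(3,4) by fastforce
qed

lemma derived_branch_inj:
  assumes "branch u a L b" "branch u a' L' b'"
    and length_eq: "derived_length L b = derived_length L' b'"
    and letter_eq: "derived b (u L) = derived b' (u L')"
  shows "L = L'" "b = b'"
proof -
  have "L = L' \<and> b = b'"
  proof (cases "zero_run b \<le> zero_run (u L)")
    case True
    then have "b = b'" "zero_run b' \<le> zero_run (u L')"
      using letter_eq by (auto simp: derived_def split: if_splits)
    then have "pos L = pos L'" using length_eq True by (simp add: derived_length_def)
    then show ?thesis using \<open>b = b'\<close> strict_mono_eq[OF strict_mono_pos] by simp
  next
    case False
    then have loses: "zero_run (u L) < zero_run b" "zero_run (u L') < zero_run b'"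
      using letter_eq by (auto simp: derived_def split: if_splits)
    have "derived (u L) b = derived (u L') b'"
      using length_eq u_derived_length branch_neq branch_le assms(1,2) by metis
    then have "u L = u L'" using loses by (simp add: derived_def)
    then have "pos L = pos L'" using length_eq loses by (simp add: derived_length_def)
    then have "L = L'" using strict_mono_eq[OF strict_mono_pos] by simp
    then show ?thesis using losing_letter_unique assms(1,2) loses by blast
  qed
  then show "L = L'" "b = b'" by simp_all
qed

lemma root_branch_left:
  assumes "branch u a L (Suc x)" "L < w ! x" "x < length w" shows "a = 0"
  using assms(1)
proof (cases rule: branch_cases)
  case (derived a' L' b')
  then have "b' = x" "zero_run x \<le> zero_run (u L')"
    by (auto simp: derived_def split: if_splits)
  then show ?thesis using derived(3) assms(2,3) by (simp add: derived_length_def zero_run_less)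
qed

theorem branch_left_unique: "branch u a L b \<Longrightarrow> branch u a' L b \<Longrightarrow> a = a'"
proof (induction arbitrary: a' rule: branch_induct)
  case (root x j)
  then show ?case using root_branch_left by simp
next
  case (derived a L b)
  from derived.prems show ?case
  proof (cases rule: branch_cases)
    case (root x)
    then show ?thesis using root_branch_left branch_derived[OF derived.hyps] by simp
  next
    case pred: (derived a2 L2 b2)
    then have "L = L2" "b = b2" using derived_branch_inj[OF derived.hyps] by simp_all
    then show ?thesis using derived.IH pred by simp
  qed
qed

lemma no_clash_if_border_is_period: "\<not> clash u c b b"
  using branch_left_unique by (auto simp: clash_def)

end

section \<open>A clash for bordered words that are not powers\<close>

lemma clash_derived:
  assumes "clash u c b b'" "min (zero_run b) (zero_run c) = min (zero_run b') (zero_run c)"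
  shows "clash u (derived c b) (derived b c) (derived b' c)"
proof -
  obtain L a a' where clashing: "u L = c" "branch u a L b" "branch u a' L b'" "a \<noteq> a'"
    using assms(1) by (auto simp: clash_def)
  have "derived_length L b = derived_length L b'"
    using assms(2) clashing(1) by (simp add: derived_length_def)
  then have "branch u (Suc a mod Suc (length w)) (derived_length L b) (derived b c)"
    "branch u (Suc a' mod Suc (length w)) (derived_length L b) (derived b' c)"
    using branch_derived[OF clashing(2)] branch_derived[OF clashing(3)] clashing(1) by simp_all
  moreover have "u (derived_length L b) = derived c b"
    using u_derived_length branch_neq[OF clashing(2)] branch_le[OF clashing(2)] clashing(1) by simp
  moreover have "Suc a mod Suc (length w) \<noteq> Suc a' mod Suc (length w)"
    using clashing(4) branch_le[OF clashing(2)] branch_le[OF clashing(3)]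
    by (auto simp: mod_Suc split: if_splits)
  ultimately show ?thesis unfolding clash_def by blast
qed

lemma clash_at_different_digits:
  assumes "x < length w" "y < length w" "w ! x < w ! y"
  shows "clash u 0 (Suc x) (Suc y)"
proof -
  have "x \<noteq> 0" using digit_le_first[OF assms(2)] assms(3) by (intro notI) simp
  have "x \<in> range u" using assms(1) by (simp add: range_u)
  then obtain i where x_at: "u (Suc i) = x" using u_0 \<open>x \<noteq> 0\<close> by (metis imageE not0_implies_Suc)
  have "w ! x < w ! 0" using digit_le_first[OF assms(2)] assms(3) by simp
  have "u i \<noteq> length w" using u_after_last_letter x_at \<open>x \<noteq> 0\<close> by metis
  then have "u i < length w" using u_le[of i] by simp
  have "branch u (u i) 0 x" using x_at \<open>x \<noteq> 0\<close> u_0 by (auto simp: branch_def deviates_def)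
  then have "branch u (Suc (u i)) (w ! x) (Suc x)"
    using branch_derived[of "u i" 0 x] assms(1) \<open>w ! x < w ! 0\<close> \<open>u i < length w\<close>
    by (simp add: derived_length_def derived_def zero_run_less zero_run_0 u_0 pos_0)
  moreover have "branch u 0 (w ! x) (Suc y)" using branch_root assms by blast
  moreover have "u (w ! x) = 0" using u_first_zeros[OF \<open>w ! x < w ! 0\<close>] .
  ultimately show ?thesis unfolding clash_def by blast
qed

lemma clash_along_equal_digits:
  assumes "clash u c b b'" "c \<sqsubset> b" "b + n \<le> length w" "b' + n \<le> length w"
    and "\<And>k. k < n \<Longrightarrow> w ! (b + k) = w ! (b' + k)"
  shows "\<exists>c'\<le>c + n. clash u c' (b + n) (b' + n) \<and> c' \<sqsubset> b + n"
  using assms(3-5)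
proof (induction n)
  case 0
  then show ?case using assms(1,2) by auto
next
  case (Suc n)
  then obtain c' where IH: "c' \<le> c + n" "clash u c' (b + n) (b' + n)" "c' \<sqsubset> b + n" by auto
  have less_length: "b + n < length w" "b' + n < length w" using Suc.prems by auto
  then have zero_runs: "zero_run (b + n) = w ! (b + n)" "zero_run (b' + n) = w ! (b + n)"
    "zero_run c' = w ! c'"
    using prefix_border_less[OF IH(3)] Suc.prems(3) by (simp_all add: zero_run_less)
  have run_le: "w ! (b + n) \<le> w ! c'" using digit_le[OF IH(3) less_length(1)] .
  have "clash u (derived c' (b + n)) (b + Suc n) (b' + Suc n)"
    using clash_derived[OF IH(2)] zero_runs run_le by (simp add: derived_def)
  moreover have "derived c' (b + n) \<sqsubset> b + Suc n"
    using prefix_border_Suc[OF IH(3) less_length(1)] zero_runs run_le less_length(1)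
    by (auto simp: derived_def prefix_border_0)
  moreover have "derived c' (b + n) \<le> c + Suc n" using IH(1) by (simp add: derived_def)
  ultimately show ?case by blast
qed

text \<open>
  Derivations in which the letter on the side of \<open>c\<close> keeps increasing: \<open>b\<close> against \<open>c\<close> becomes
  \<open>b'\<close> against \<open>c + n\<close>, whatever the position.
\<close>

inductive pursues :: "nat \<Rightarrow> nat \<Rightarrow> nat \<Rightarrow> nat \<Rightarrow> bool" for c b where
  pursues_0: "pursues c b 0 b"
| pursues_Suc: "pursues c b n b' \<Longrightarrow> zero_run (c + n) \<le> zero_run b' \<Longrightarrow>
    pursues c b (Suc n) (derived b' (c + n))"

lemma pursues_1: "zero_run c \<le> zero_run b \<Longrightarrow> pursues c b 1 (derived b c)"
  using pursues_Suc[OF pursues_0, of c b] by simp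

lemma pursues_add: "pursues (c + m) b' n b'' \<Longrightarrow> pursues c b m b' \<Longrightarrow> pursues c b (m + n) b''"
proof (induction rule: pursues.induct)
  case (pursues_Suc n b'')
  then show ?case using pursues.pursues_Suc[of c b "m + n" b''] by (simp add: add.assoc)
qed simp

lemma clash_pursues:
  "pursues c b1 n b1' \<Longrightarrow> pursues c b2 n b2' \<Longrightarrow> clash u c b1 b2 \<Longrightarrow> clash u (c + n) b1' b2'"
proof (induction arbitrary: b2' rule: pursues.induct)
  case pursues_0
  from pursues_0.prems(1) show ?case
    by cases (use pursues_0.prems in simp_all)
next
  case (pursues_Suc n b1')
  from pursues_Suc.prems(1) obtain b2'' where predecessor: "pursues c b2 n b2''"
    "zero_run (c + n) \<le> zero_run b2''" "b2' = derived b2'' (c + n)" by cases auto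
  have "clash u (c + n) b1' b2''" using pursues_Suc.IH predecessor(1) pursues_Suc.prems(2) .
  moreover have "derived (c + n) b1' = c + Suc n"
    using pursues_Suc.hyps(2) by (simp add: derived_def)
  ultimately show ?case
    using clash_derived[of "c + n" b1' b2''] pursues_Suc.hyps(2) predecessor(2,3)
    by (simp add: min_absorb2)
qed

lemma pursues_equal_digits:
  assumes "b + n \<le> length w" "c \<le> b" "\<And>k. k < n \<Longrightarrow> w ! (b + k) = w ! (c + k)"
  shows "pursues c b n (b + n)"
  using assms
proof (induction n)
  case 0
  then show ?case by (simp add: pursues_0)
next
  case (Suc n)
  then have "pursues c b n (b + n)" "zero_run (b + n) = zero_run (c + n)"
    by (simp_all add: zero_run_less)
  then show ?case using pursues_Suc[of c b n "b + n"] by (simp add: derived_def)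
qed

lemma pursues_border: "c \<sqsubset> length w \<Longrightarrow> pursues 0 (length w - c) c (length w)"
  using pursues_equal_digits[of "length w - c" c 0] by (auto simp: prefix_border_iff_nth)

lemma pursues_smaller:
  assumes "b \<sqsubset> c" "c + n \<le> length w"
  shows "\<exists>b'. pursues c b n b' \<and> b' \<sqsubset> c + n \<and> b' \<le> b + n"
  using assms(2)
proof (induction n)
  case 0
  then show ?case using assms(1) pursues_0 by auto
next
  case (Suc n)
  then obtain b' where IH: "pursues c b n b'" "b' \<sqsubset> c + n" "b' \<le> b + n" by auto
  have c_less: "c + n < length w" using Suc.prems by simp
  then have zero_runs: "zero_run (c + n) = w ! (c + n)" "zero_run b' = w ! b'"
    using prefix_border_less[OF IH(2)] by (simp_all add: zero_run_less)
  have run_le: "w ! (c + n) \<le> w ! b'" using digit_le[OF IH(2) c_less] .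
  have "derived b' (c + n) \<sqsubset> c + Suc n"
    using prefix_border_Suc[OF IH(2) c_less] zero_runs run_le c_less
    by (auto simp: derived_def prefix_border_0)
  moreover have "derived b' (c + n) \<le> b + Suc n" using IH(3) by (simp add: derived_def)
  moreover have "pursues c b (Suc n) (derived b' (c + n))"
    using pursues_Suc IH(1) zero_runs run_le by simp
  ultimately show ?case by blast
qed

lemma pursues_last_letter:
  assumes "0 < n" "c + n \<le> length w"
  shows "\<exists>b'. pursues c (length w) n b' \<and> b' \<sqsubset> c + n \<and> b' < n"
proof -
  obtain m where n_eq: "n = 1 + m" using assms(1) by (metis Suc_eq_plus1_left gr0_implies_Suc)
  have loses: "zero_run c < zero_run (length w)" using zero_run_less_last assms by simp
  then have first_step: "pursues c (length w) 1 0"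
    using pursues_1[of c "length w"] by (simp add: derived_def)
  have "0 \<sqsubset> c + 1" using assms by (simp add: prefix_border_0)
  then obtain b' where "pursues (c + 1) 0 m b'" "b' \<sqsubset> c + 1 + m" "b' \<le> m"
    using pursues_smaller[of 0 "c + 1" m] assms(2) n_eq by auto
  moreover from this(1) have "pursues c (length w) n b'"
    unfolding n_eq by (rule pursues_add[OF _ first_step])
  ultimately show ?thesis using n_eq by (auto simp: add.assoc)
qed

lemma clash_if_both_lose:
  assumes "clash u c b b'" "zero_run c < zero_run b" "zero_run c < zero_run b'"
  shows "clash u (Suc c) 0 0"
  using clash_derived[OF assms(1)] assms(2,3) by (simp add: derived_def)

context
  fixes p x :: "nat list" and q :: nat
  assumes decomposition: "w = p @ x @ word_power x q"
    and power_prefix: "prefix (x @ word_power x q) w"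
    and shortest_border: "\<And>r. 0 < r \<Longrightarrow> r < length x \<Longrightarrow> \<not> r \<sqsubset> length w"
    and p_nonempty: "p \<noteq> []"
    and x_nonempty: "x \<noteq> []"
    and incomparable: "\<not> suffix x p" "\<not> suffix p x"
begin

abbreviation full_length :: nat where "full_length \<equiv> length (x @ word_power x q)"

abbreviation short_length :: nat where "short_length \<equiv> length (word_power x q)"

lemma take_power_lengths:
  "take full_length w = x @ word_power x q" "take short_length w = word_power x q"
  "take (length x) w = x"
proof -
  obtain y where w_eq: "w = x @ word_power x q @ y" using power_prefix by (auto simp: prefix_def)
  then show "take full_length w = x @ word_power x q" "take (length x) w = x" by simp_all
  show "take short_length w = word_power x q" unfolding w_eq append_word_power by simp
qed

lemma power_borders:
  "full_length \<sqsubset> length w" "short_length \<sqsubset> length w" "length x \<sqsubset> length w"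
proof -
  have "suffix (x @ word_power x q) w" "suffix (word_power x q) w"
    by (simp_all add: decomposition suffix_appendI)
  moreover have "w = p @ word_power x q @ x"
    using decomposition append_word_power[of x q "[]"] by simp
  then have "suffix x w" by (metis suffixI append_assoc)
  moreover have "full_length < length w" "short_length < length w" "length x < length w"
    using p_nonempty by (simp_all add: decomposition)
  ultimately show "full_length \<sqsubset> length w" "short_length \<sqsubset> length w" "length x \<sqsubset> length w"
    using take_power_lengths by (simp_all add: prefix_border_def)
qed

lemma small_border_of_border_eq_0:
  assumes "r \<sqsubset> b" "b \<sqsubset> length w" "r < length x" shows "r = 0"
  using shortest_border[of r] prefix_border_trans[OF assms(1,2)] assms(3) by blast

lemma clash_before_powers: "clash u 0 (length p + length x) (length p)"
proof -
  obtain x' h p' g z where "h \<noteq> g" and x_eq: "x = x' @ h # z" and p_eq: "p = p' @ g # z"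
    using suffix_incomparable_decomposition[OF incomparable] .
  define i j where "i = length p + length x'" and "j = length p'"
  have w_h: "w = (p @ x') @ h # z @ word_power x q" using decomposition x_eq by simp
  have w_g: "w = p' @ g # z @ x @ word_power x q" using decomposition p_eq by simp
  have branching: "w ! i = h" "w ! j = g"
    using arg_cong[OF w_h, of "\<lambda>v. v ! i"] arg_cong[OF w_g, of "\<lambda>v. v ! j"]
    by (simp_all add: i_def j_def)
  have same: "w ! (Suc i + k) = w ! (Suc j + k)" if "k < length z" for k
    using arg_cong[OF w_h, of "\<lambda>v. v ! (Suc i + k)"]
      arg_cong[OF w_g, of "\<lambda>v. v ! (Suc j + k)"] that
    by (simp add: i_def j_def nth_append)
  have ends: "Suc i + length z = length p + length x" "Suc j + length z = length p"
    "length p + length x \<le> length w"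
    by (simp_all add: i_def j_def x_eq p_eq decomposition)
  then have "clash u 0 (Suc i) (Suc j)"
    using clash_at_different_digits[of i j] clash_at_different_digits[of j i] clash_commute
      \<open>h \<noteq> g\<close> branching by (cases "h < g") auto
  moreover have "0 \<sqsubset> Suc i" using ends by (simp add: prefix_border_0)
  ultimately obtain c where parallel: "c \<le> length z" "clash u c (length p + length x) (length p)"
    "c \<sqsubset> length p + length x"
    using clash_along_equal_digits[of 0 "Suc i" "Suc j" "length z"] ends same by auto
  have "take (length p + length x) w = p @ x" by (simp add: decomposition)
  then have "length x \<sqsubset> length p + length x"
    using p_nonempty take_power_lengths(3) ends(3) by (simp add: prefix_border_def suffix_appendI)
  moreover have "c < length x" using parallel(1) x_eq by simp
  ultimately have "c \<sqsubset> length x" using prefix_border_linear parallel(3) by blast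
  then have "c = 0" using small_border_of_border_eq_0 power_borders(3) \<open>c < length x\<close> by blast
  then show ?thesis using parallel(2) by simp
qed

lemma clash_after_powers: "clash u full_length 0 (length w)"
proof -
  have "pursues 0 (length p) full_length (length w)"
    using pursues_border[OF power_borders(1)] by (simp add: decomposition)
  moreover have "pursues 0 (length p + length x) full_length 0"
  proof -
    have "full_length = short_length + length x" by simp
    then obtain b where "pursues short_length (length w) (length x) b"
      "b \<sqsubset> full_length" "b < length x"
      using pursues_last_letter[of "length x" short_length] x_nonempty
        prefix_border_less[OF power_borders(1)] by (metis length_greater_0_conv less_imp_le)
    moreover from this have "b = 0" using small_border_of_border_eq_0 power_borders(1) by blast
    moreover have "pursues 0 (length p + length x) short_length (length w)"
      using pursues_border[OF power_borders(2)] by (simp add: decomposition)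
    ultimately show ?thesis
      using pursues_add[of 0 short_length "length w" "length x" b] by (simp add: add.commute)
  qed
  ultimately show ?thesis using clash_pursues clash_before_powers by fastforce
qed

lemma ex_clash_if_not_power:
  assumes "\<not> proper_power w" shows "\<exists>c. clash u c 0 0"
proof -
  have positive: "0 < full_length" using x_nonempty by simp
  obtain e where mismatch: "full_length + e < length w" "e \<sqsubset> full_length + e"
    "w ! (full_length + e) < w ! e"
    using suffix_maximal_mismatch[OF maximal positive]
      border_period_imp_proper_power[OF power_borders(1) positive] assms by blast
  have loses: "zero_run (full_length + e) < zero_run b"
    if small_border: "b \<sqsubset> full_length + e" "b \<le> e" for b
  proof -
    have "w ! e \<le> w ! b"
      using prefix_border_linear[OF small_border(1) mismatch(2)] digit_le[of b e]
        small_border(2) mismatch(1) by (cases "b = e") auto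
    then show ?thesis using mismatch small_border(2) by (simp add: zero_run_less)
  qed
  have "0 \<sqsubset> full_length" using positive mismatch(1) by (intro prefix_border_0) auto
  then obtain b where pursuit_0: "pursues full_length 0 e b"
    "zero_run (full_length + e) < zero_run b"
    using pursues_smaller[of 0 full_length e] mismatch(1) loses by auto
  obtain b' where pursuit_last: "pursues full_length (length w) e b'"
    "zero_run (full_length + e) < zero_run b'"
  proof (cases "e = 0")
    case True
    then show ?thesis using that[of "length w"] pursues_0 zero_run_less_last mismatch(1) by simp
  next
    case False
    then show ?thesis using that pursues_last_letter[of e full_length] loses mismatch(1) by auto
  qed
  have "clash u (full_length + e) b b'"
    using clash_pursues[OF pursuit_0(1) pursuit_last(1) clash_after_powers] .
  then show ?thesis using clash_if_both_lose pursuit_0(2) pursuit_last(2) by blast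
qed

end

theorem ex_clash_iff:
  "(\<exists>c b. clash u c b b) \<longleftrightarrow> (\<exists>s>0. s \<sqsubset> length w) \<and> \<not> proper_power w"
proof
  assume "\<exists>c b. clash u c b b"
  then show "(\<exists>s>0. s \<sqsubset> length w) \<and> \<not> proper_power w"
    using no_clash_if_border_is_period border_of_power_is_period[OF maximal] by blast
next
  assume "(\<exists>s>0. s \<sqsubset> length w) \<and> \<not> proper_power w"
  then obtain s where s_border: "0 < s" "s \<sqsubset> length w" and "\<not> proper_power w" by blast
  then show "\<exists>c b. clash u c b b"
    using bordered_nonpower_decomposition[OF maximal s_border] ex_clash_if_not_power by metis
qed

end

lemma suffix_maximal_butlast_if_simple_parry:
  assumes "simple_parry \<beta> t"
  shows "suffix_maximal (butlast t)"
  unfolding suffix_maximal_def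
proof (intro allI impI)
  let ?w = "butlast t"
  fix v assume "suffix v ?w"
  then obtain i where v_eq: "i \<le> length ?w" "v = drop i ?w"
    by (metis append_eq_conv_conj length_append le_add1 suffix_def)
  show "v \<le> ?w"
  proof (cases "i = 0")
    case False
    then have "lex_less_seq (pad_zero (drop i t)) (pad_zero t)"
      using assms v_eq(1) by (auto simp: simple_parry_def)
    then obtain k where smaller: "\<And>j. j < k \<Longrightarrow> pad_zero (drop i t) j = pad_zero t j"
      "pad_zero (drop i t) k < pad_zero t k" by (auto simp: lex_less_seq_def)
    have digit: "pad_zero (drop i t) j = v ! j" "pad_zero t j = ?w ! j" if "j < length v" for j
      using that v_eq by (auto simp: pad_zero_def nth_butlast)
    show ?thesis
    proof (cases "k < length v")
      case True
      then have "v < ?w"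
        using v_eq smaller digit unfolding list_less_def lexord_take_index_conv
        by (intro disjI2 exI[of _ k]) (auto intro!: nth_equalityI)
      then show ?thesis by simp
    next
      case False
      then have "v = take (length v) ?w" using v_eq smaller(1) digit by (intro nth_equalityI) auto
      then show ?thesis by (metis prefix_imp_le take_is_prefix)
    qed
  qed (use v_eq in simp)
qed

theorem theorem1:
  fixes \<beta> :: real and t :: "nat list"
  assumes "simple_parry \<beta> t" and "length t \<ge> 2"
  shows "(\<exists>a b :: real. \<forall>n. real (complexity (u_beta t) n) = a * real n + b)
    \<longleftrightarrow> (last t = 1 \<and>
         ((\<exists>w k. k \<ge> 2 \<and> butlast t = concat (replicate k w)) \<or>
          \<not> (\<exists>v. v \<noteq> [] \<and> strict_prefix v (butlast t) \<and> strict_suffix v (butlast t))))"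
proof -
  have t_eq: "t = butlast t @ [last t]"
    using assms(2) by (intro append_butlast_last_id[symmetric]) auto
  interpret parry_substitution "butlast t" "last t"
    using assms
    by unfold_locales (auto simp: simple_parry_def nth_butlast simp flip: length_greater_0_conv)
  have affine: "affine_seq (complexity (u_beta t)) \<longleftrightarrow> \<not> (\<exists>c b. clash u c b b)"
    using affine_complexity_iff_no_clash u_beta_eq t_eq by simp
  show ?thesis
  proof (cases "last t = 1")
    case True
    interpret unit_parry_substitution "butlast t" "last t"
      using suffix_maximal_butlast_if_simple_parry[OF assms(1)] True by unfold_locales
    show ?thesis
      using affine ex_clash_iff True
      unfolding affine_seq_def proper_power_def ex_proper_border_iff by blast
  next
    case False
    then have "clash u 1 0 0" using last_digit_pos by (intro clash_if_last_digit_ge_2) simp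
    then show ?thesis using affine False by (auto simp: affine_seq_def)
  qed
qed

end
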